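(* Let $G\subset\mathrm{PSL}(3,\mathbb C)$ be a discrete $\theta$-divergent subgroup, let $\Lambda_\theta(G)\subset\mathrm{Fl}(\mathbb P^2_{\mathbb C})$ be its full-flag limit set, and let $\widehat\Lambda_{\mathrm{CoG}}(G)\subset\check{\mathbb P}^2_{\mathbb C}$ be its extended Conze–Guivarc'h limit set. Then every element of the pseudo-projective boundary $\mathcal B_{\mathrm{SP},G}$ has rank one. With the canonical bidual identification, one has $$\widehat\Lambda_{\mathrm{CoG}}(\check G)=\pi_1(\Lambda_\theta(G))\subset\mathbb P^2_{\mathbb C},\qquad \widehat\Lambda_{\mathrm{CoG}}(G)=\pi_2(\Lambda_\theta(G))\subset\check{\mathbb P}^2_{\mathbb C}.$$ Moreover, writing $\mathrm{Th}_{\mathrm{inc}}(\Lambda_\theta(G)):=\bigcup_{(p,\ell)\in\Lambda_\theta(G)}\ell$, one has $$\Lambda_{\mathrm{Myr}}(G)=\bigcup_{[\ell]\in\widehat\Lambda_{\mathrm{CoG}}(G)}\ell=\mathrm{Th}_{\mathrm{inc}}(\Lambda_\theta(G)),\qquad \mathrm{Eq}(G)=\mathbb P^2_{\mathbb C}\setminus\mathrm{Th}_{\mathrm{inc}}(\Lambda_\theta(G)),$$ and the action of $G$ on $\mathrm{Eq}(G)$ is properly discontinuous. If, in addition, $\Lambda_{\mathrm{Kul}}(G)$ contains at least three projective lines in general position, then $$\Lambda_{\mathrm{Kul}}(G)=\Lambda_{\mathrm{Myr}}(G)=\bigcup_{[\ell]\in\widehat\Lambda_{\mathrm{CoG}}(G)}\ell=\mathrm{Th}_{\mathrm{inc}}(\Lambda_\theta(G)),$$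 $$\Omega_{\mathrm{Kul}}(G)=\mathrm{Eq}(G)=\mathbb P^2_{\mathbb C}\setminus\mathrm{Th}_{\mathrm{inc}}(\Lambda_\theta(G)).$$
   Context: $\mathrm{PSL}(3,\mathbb C)$ acts on the complex projective plane $\mathbb P^2_{\mathbb C}$. $\check{\mathbb P}^2_{\mathbb C}$ is the dual projective plane; a line $\ell\subset\mathbb P^2_{\mathbb C}$ corresponds to a point $[\ell]\in\check{\mathbb P}^2_{\mathbb C}$. $\mathrm{Fl}(\mathbb P^2_{\mathbb C})$ is the variety of full flags $(p,\ell)$ with $p\in\ell$; $\pi_1(p,\ell)=p$ and $\pi_2(p,\ell)=[\ell]$. Lines are in general position if they are distinct and no three are concurrent. Cartan data. Every $g\in\mathrm{PSL}(3,\mathbb C)$ has a lift to $\mathrm{SL}(3,\mathbb C)$ of the form $k_1ak_2$ with $k_1,k_2\in\mathrm{SU}(3)$, $a=\mathrm{diag}(e^{\lambda_1},e^{\lambda_2},e^{\lambda_3})$, $\lambda_1\ge\lambda_2\ge\lambda_3$, $\lambda_1+\lambda_2+\lambda_3=0$; the $\lambda_i=\lambda_i(g)$ are uniquely determined. Put $\delta_1(g)=\lambda_1(g)-\lambda_2(g)$, $\delta_2(g)=\lambda_2(g)-\lambda_3(g)$. A subgroup $G$ is $\theta$-divergent if for every sequence $(g_n)$ of pairwise distinct elements of $G$ one has $\delta_1(g_n)\to+\infty$ and $\delta_2(g_n)\to+\infty$. If $\delta_1(g),\delta_2(g)>0$, the left singular flag is $U(g):=k_1([e_1],\mathbb P\langle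 e_1,e_2\rangle)$ (well defined). For a $\theta$-divergent group all but finitely many terms of a sequence of distinct elements have positive gaps, and $\Lambda_\theta(G):=\{F\in\mathrm{Fl}(\mathbb P^2_{\mathbb C}):\text{there are pairwise distinct } g_n\in G \text{ with } U(g_n)\to F\}$. Pseudo-projective boundary. $\mathrm{SP}(3,\mathbb C):=(M_{3\times3}(\mathbb C)\setminus\{0\})/\mathbb C^*$, which contains $\mathrm{PSL}(3,\mathbb C)$; the rank of a class is the rank of any representative. $\mathcal B_{\mathrm{SP},G}$ is the set of all $S\in\mathrm{SP}(3,\mathbb C)$ that are limits of sequences of distinct elements of $G$. Extended Conze–Guivarc'h limit set. $G$ acts on $\check{\mathbb P}^2_{\mathbb C}$ by the induced dual action $[\ell]\mapsto[g(\ell)]$ (contragredient, $g\mapsto g^{-T}$). $[\ell]\in\widehat\Lambda_{\mathrm{CoG}}(G)\subset\check{\mathbb P}^2_{\mathbb C}$ iff there is a sequence of distinct elements of $G$ whose induced dual action converges to the constant point $[\ell]$ on a nonempty open subset of $\check{\mathbb P}^2_{\mathbb C}$. $\check G$ denotes the contragredient group of $G$ acting on $\check{\mathbb P}^2_{\mathbb C}$; the dual of that action is canonically the original action of $G$ on $\mathbb P^2_{\mathbb C}$ (bidual identification), so $\widehat\Lambda_{\mathrm{CoG}}(\check G)$ is regarded as a subset of $\mathbb P^2_{\mathbb C}$. Equicontinuity and Myrberg set. $\mathrm{Eq}(G)$ is the set of points of $\mathbb P^2_{\mathbb C}$ having a neighborhood on which $G$ is an equicontinuous (normal) family; $\Lambda_{\mathrm{Myr}}(G):=\mathbb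 P^2_{\mathbb C}\setminus\mathrm{Eq}(G)$. Kulkarni limit set. $L_0(G)$ is the closure of the set of points with infinite stabilizer in $G$; $L_1(G)$ is the closure of the set of accumulation points of orbits $Gz$ with $z\in\mathbb P^2_{\mathbb C}\setminus L_0(G)$; $L_2(G)$ is the closure of the set of accumulation points of the families $\{g(K)\}_{g\in G}$ with $K$ compact in $\mathbb P^2_{\mathbb C}\setminus(L_0(G)\cup L_1(G))$. $\Lambda_{\mathrm{Kul}}(G)=L_0(G)\cup L_1(G)\cup L_2(G)$ and $\Omega_{\mathrm{Kul}}(G)=\mathbb P^2_{\mathbb C}\setminus\Lambda_{\mathrm{Kul}}(G)$. *)

theory Defs
  imports "HOL-Analysis.Analysis" "HOL-Algebra.Group"
begin

section \<open>The complex projective plane\<close>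

definition proj_rel :: "complex^3 \<Rightarrow> complex^3 \<Rightarrow> bool" where
  "proj_rel v w \<longleftrightarrow> v \<noteq> 0 \<and> w \<noteq> 0 \<and> (\<exists>c. c \<noteq> 0 \<and> w = c *s v)"

lemma part_equivp_proj_rel: "part_equivp proj_rel"
proof (rule part_equivpI)
  show "\<exists>x. proj_rel x x"
    by (rule exI[of _ "axis 1 1"]) (auto simp: proj_rel_def intro!: exI[of _ 1])
  show "symp proj_rel"
  proof (rule sympI)
    fix v w assume "proj_rel v w"
    then obtain c where "v \<noteq> 0" "w \<noteq> 0" "c \<noteq> 0" "w = c *s v"
      by (auto simp: proj_rel_def)
    then show "proj_rel w v"
      unfolding proj_rel_def by (auto intro!: exI[of _ "inverse c"] simp: vector_smult_assoc)
  qed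
  show "transp proj_rel"
  proof (rule transpI)
    fix u v w assume "proj_rel u v" "proj_rel v w"
    then obtain c d where "u \<noteq> 0" "w \<noteq> 0" "c \<noteq> 0" "d \<noteq> 0" "v = c *s u" "w = d *s v"
      by (auto simp: proj_rel_def)
    then show "proj_rel u w"
      unfolding proj_rel_def by (auto intro!: exI[of _ "d * c"] simp: vector_smult_assoc)
  qed
qed

quotient_type cp2 = "complex^3" / partial: proj_rel
  morphisms rep_cp2 cp2_of
  by (rule part_equivp_proj_rel)

lemma rep_cp2_nonzero: "rep_cp2 x \<noteq> 0"
  using Quotient3_rep_reflp[OF Quotient3_cp2, of x] by (simp add: proj_rel_def)

lemma cp2_of_rep [simp]: "cp2_of (rep_cp2 x) = x"
  by (rule Quotient3_abs_rep[OF Quotient3_cp2])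

lemma cp2_of_eq_iff:
  assumes "v \<noteq> 0" "w \<noteq> 0"
  shows "cp2_of v = cp2_of w \<longleftrightarrow> (\<exists>c. c \<noteq> 0 \<and> w = c *s v)"
proof -
  have refl: "proj_rel u u" if "u \<noteq> 0" for u
    using that by (auto simp: proj_rel_def intro!: exI[of _ 1])
  have "proj_rel v w \<longleftrightarrow> cp2_of v = cp2_of w"
    using Quotient3_rel[OF Quotient3_cp2, of v w] refl[OF assms(1)] refl[OF assms(2)] by simp
  then show ?thesis
    using assms by (auto simp: proj_rel_def)
qed

lemma rep_cp2_of:
  assumes "v \<noteq> 0"
  obtains c where "c \<noteq> 0" "rep_cp2 (cp2_of v) = c *s v"
  using cp2_of_eq_iff[OF assms rep_cp2_nonzero, of "cp2_of v"] by auto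

text \<open>
  The topology is the quotient topology of \<open>\<complex>\<^sup>3 - {0}\<close>. The metric is the norm distance between the
  Hermitian projections onto the lines of \<open>\<complex>\<^sup>3\<close>; that it induces the quotient topology
  is part of the instance proof below.
\<close>

definition line_projector :: "complex^3 \<Rightarrow> complex^3^3" where
  "line_projector v = (\<chi> i j. v $ i * cnj (v $ j) / of_real ((norm v)\<^sup>2))"

lemma norm_cvec_sq: "complex_of_real ((norm v)\<^sup>2) = (\<Sum>i\<in>UNIV. v $ i * cnj (v $ i))" for v :: "complex^3"
proof -
  have "(norm v)\<^sup>2 = (\<Sum>i\<in>UNIV. (norm (v $ i))\<^sup>2)"
    by (simp add: norm_vec_def L2_set_def sum_nonneg)
  then show ?thesis
    by (simp only: of_real_sum complex_norm_square)
qed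

lemma norm_cvec_smult: "norm (c *s v) = cmod c * norm v" for v :: "complex^3"
  by (simp add: norm_vec_def norm_mult L2_set_right_distrib)

lemma line_projector_smult:
  assumes "c \<noteq> 0"
  shows "line_projector (c *s v) = line_projector v"
proof -
  have "(c * v $ i) * cnj (c * v $ j) / of_real ((norm (c *s v))\<^sup>2)
        = v $ i * cnj (v $ j) / of_real ((norm v)\<^sup>2)" for i j
  proof -
    have "complex_of_real ((norm (c *s v))\<^sup>2) = (c * cnj c) * of_real ((norm v)\<^sup>2)"
      by (simp only: norm_cvec_smult power_mult_distrib of_real_mult complex_norm_square)
    then have "(c * v $ i) * cnj (c * v $ j) / of_real ((norm (c *s v))\<^sup>2)
        = ((c * cnj c) * (v $ i * cnj (v $ j))) / ((c * cnj c) * of_real ((norm v)\<^sup>2))"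
      by (simp only: complex_cnj_mult mult_ac)
    also have "\<dots> = v $ i * cnj (v $ j) / of_real ((norm v)\<^sup>2)"
      by (rule mult_divide_mult_cancel_left) (use assms in simp)
    finally show ?thesis .
  qed
  then show ?thesis
    unfolding line_projector_def by (simp add: vec_eq_iff)
qed

lemma line_projector_rep: "v \<noteq> 0 \<Longrightarrow> line_projector (rep_cp2 (cp2_of v)) = line_projector v"
  by (metis rep_cp2_of line_projector_smult)

lemma line_projector_apply:
  "line_projector w *v v = ((\<Sum>j\<in>UNIV. v $ j * cnj (w $ j)) / of_real ((norm w)\<^sup>2)) *s w"
  by (simp add: line_projector_def matrix_vector_mult_def vec_eq_iff sum_distrib_left
      sum_distrib_right sum_divide_distrib mult_ac)

lemma line_projector_self: "v \<noteq> 0 \<Longrightarrow> line_projector v *v v = v"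
  by (simp only: line_projector_apply norm_cvec_sq [symmetric]) simp

lemma cp2_of_line_projector_apply:
  assumes "w \<noteq> 0" "line_projector w *v v \<noteq> 0"
  shows "cp2_of (line_projector w *v v) = cp2_of w"
proof -
  obtain c where c: "line_projector w *v v = c *s w"
    using line_projector_apply by blast
  with assms(2) have "c \<noteq> 0" by auto
  then show ?thesis
    using cp2_of_eq_iff[OF assms] c by auto
qed

instantiation cp2 :: metric_space
begin

definition open_cp2 :: "cp2 set \<Rightarrow> bool" where
  "open_cp2 U \<longleftrightarrow> open {v. v \<noteq> 0 \<and> cp2_of v \<in> U}"

definition dist_cp2 :: "cp2 \<Rightarrow> cp2 \<Rightarrow> real" where
  "dist_cp2 x y = dist (line_projector (rep_cp2 x)) (line_projector (rep_cp2 y))"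

definition uniformity_cp2 :: "(cp2 \<times> cp2) filter" where
  "uniformity_cp2 = (INF e\<in>{0<..}. principal {(x, y). dist x y < e})"

instance
proof
  show "(uniformity :: (cp2 \<times> cp2) filter) = (INF e\<in>{0<..}. principal {(x, y). dist x y < e})"
    by (rule uniformity_cp2_def)
next
  fix x y :: cp2
  have "x = y" if eq: "line_projector (rep_cp2 x) = line_projector (rep_cp2 y)"
  proof -
    have "line_projector (rep_cp2 y) *v rep_cp2 x = rep_cp2 x"
      using line_projector_self[OF rep_cp2_nonzero, of x] eq by simp
    then show ?thesis
      using cp2_of_line_projector_apply[of "rep_cp2 y" "rep_cp2 x"] rep_cp2_nonzero by simp
  qed
  then show "dist x y = 0 \<longleftrightarrow> x = y"
    by (auto simp: dist_cp2_def)
next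
  fix x y z :: cp2
  show "dist x y \<le> dist x z + dist y z"
    unfolding dist_cp2_def by (rule dist_triangle2)
next
  fix U :: "cp2 set"
  let ?P = "{v. v \<noteq> 0 \<and> cp2_of v \<in> U}"
  have ball: "(\<forall>x\<in>U. \<forall>\<^sub>F (x', y) in uniformity. x' = x \<longrightarrow> y \<in> U)
      \<longleftrightarrow> (\<forall>x\<in>U. \<exists>e>0. \<forall>y. dist x y < e \<longrightarrow> y \<in> U)"
  proof (rule ball_cong[OF refl])
    fix x assume "x \<in> U"
    have "(\<forall>\<^sub>F (x', y) in uniformity. x' = x \<longrightarrow> y \<in> U)
      \<longleftrightarrow> (\<exists>e\<in>{0<..}. \<forall>(x', y)\<in>{(x, y). dist x y < e}. x' = x \<longrightarrow> y \<in> U)"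
      unfolding uniformity_cp2_def
    proof (subst eventually_INF_base, goal_cases)
      case (2 a b)
      then show ?case by (intro bexI[of _ "min a b"]) auto
    qed (auto simp: eventually_principal)
    then show "(\<forall>\<^sub>F (x', y) in uniformity. x' = x \<longrightarrow> y \<in> U)
      \<longleftrightarrow> (\<exists>e>0. \<forall>y. dist x y < e \<longrightarrow> y \<in> U)"
      by auto
  qed
  have "open ?P" if U: "\<forall>x\<in>U. \<exists>e>0. \<forall>y. dist x y < e \<longrightarrow> y \<in> U"
  proof (subst open_subopen, rule ballI)
    fix v assume v: "v \<in> ?P"
    then obtain e where e: "e > 0" "\<And>y. dist (cp2_of v) y < e \<Longrightarrow> y \<in> U"
      using U by blast
    have "((\<lambda>w. line_projector w) \<longlongrightarrow> line_projector v) (nhds v)"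
      unfolding line_projector_def using v
      by (intro tendsto_intros filterlim_ident) auto
    then have "\<forall>\<^sub>F w in nhds v. dist (line_projector w) (line_projector v) < e"
      using e(1) by (rule tendstoD)
    moreover have "\<forall>\<^sub>F w in nhds v. w \<noteq> 0"
      using v by (intro t1_space_nhds) auto
    ultimately have "\<forall>\<^sub>F w in nhds v. w \<in> ?P"
    proof eventually_elim
      case (elim w)
      then have "dist (cp2_of v) (cp2_of w) < e"
        using v by (simp add: dist_cp2_def line_projector_rep dist_commute)
      then show ?case using e(2) elim by simp
    qed
    then show "\<exists>T. open T \<and> v \<in> T \<and> T \<subseteq> ?P"
      unfolding eventually_nhds by blast
  qed
  moreover have "\<exists>e>0. \<forall>y. dist x y < e \<longrightarrow> y \<in> U" if "open ?P" "x \<in> U" for x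
  proof -
    let ?v = "rep_cp2 x"
    have "((\<lambda>A :: complex^3^3. A *v ?v) \<longlongrightarrow> line_projector ?v *v ?v) (nhds (line_projector ?v))"
      unfolding matrix_vector_mult_def by (intro tendsto_intros filterlim_ident)
    then have "\<forall>\<^sub>F A in nhds (line_projector ?v). A *v ?v \<in> ?P"
      using that by (elim topological_tendstoD)
        (auto simp: line_projector_self[OF rep_cp2_nonzero] rep_cp2_nonzero)
    then obtain e where e: "e > 0"
      "\<And>A. dist A (line_projector ?v) < e \<Longrightarrow> A *v ?v \<in> ?P"
      unfolding eventually_nhds_metric by blast
    have "y \<in> U" if "dist x y < e" for y
    proof -
      have "line_projector (rep_cp2 y) *v ?v \<in> ?P"
        using that by (intro e(2)) (simp add: dist_cp2_def dist_commute)
      then show ?thesis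
        using cp2_of_line_projector_apply[OF rep_cp2_nonzero, of y ?v] by simp
    qed
    with e(1) show ?thesis by blast
  qed
  ultimately show "open U \<longleftrightarrow> (\<forall>x\<in>U. \<forall>\<^sub>F (x', y) in uniformity. x' = x \<longrightarrow> y \<in> U)"
    unfolding ball open_cp2_def by blast
qed

end


text \<open>
  A point \<open>[\<phi>]\<close> of the dual plane is given by its homogeneous line coordinates \<open>\<phi>\<close> (a functional
  on \<open>\<complex>\<^sup>3\<close> in the dual basis). In these coordinates the identification of the plane with its bidual is
  the identity, and a projective map with matrix \<open>A\<close> acts on lines by the inverse transpose of \<open>A\<close>.
\<close>

type_synonym dual_cp2 = cp2

definition incident :: "cp2 \<Rightarrow> dual_cp2 \<Rightarrow> bool" where
  "incident p l \<longleftrightarrow> (\<Sum>i\<in>UNIV. rep_cp2 l $ i * rep_cp2 p $ i) = 0"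

definition line_of :: "dual_cp2 \<Rightarrow> cp2 set" where
  "line_of l = {p. incident p l}"

lemma incident_cp2_of:
  assumes "v \<noteq> 0" "f \<noteq> 0"
  shows "incident (cp2_of v) (cp2_of f) \<longleftrightarrow> (\<Sum>i\<in>UNIV. f $ i * v $ i) = 0"
proof -
  obtain c where c: "c \<noteq> 0" "rep_cp2 (cp2_of v) = c *s v" using rep_cp2_of[OF assms(1)] .
  obtain d where d: "d \<noteq> 0" "rep_cp2 (cp2_of f) = d *s f" using rep_cp2_of[OF assms(2)] .
  have "(\<Sum>i\<in>UNIV. (d *s f) $ i * (c *s v) $ i) = (d * c) * (\<Sum>i\<in>UNIV. f $ i * v $ i)"
    by (simp add: sum_distrib_left mult_ac)
  then show ?thesis
    using c d by (simp add: incident_def)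
qed

definition flags :: "(cp2 \<times> dual_cp2) set" where
  "flags = {(p, l). incident p l}"

definition lines_in_general_position :: "dual_cp2 set \<Rightarrow> bool" where
  "lines_in_general_position A \<longleftrightarrow>
     (\<forall>a\<in>A. \<forall>b\<in>A. \<forall>c\<in>A. a \<noteq> b \<and> a \<noteq> c \<and> b \<noteq> c \<longrightarrow> line_of a \<inter> line_of b \<inter> line_of c = {})"


section \<open>Pseudo-projective maps and the projective special linear group\<close>

definition sp_rel :: "complex^3^3 \<Rightarrow> complex^3^3 \<Rightarrow> bool" where
  "sp_rel A B \<longleftrightarrow> A \<noteq> 0 \<and> B \<noteq> 0 \<and> (\<exists>c. c \<noteq> 0 \<and> B = mat c ** A)"

lemma mat_mult_nth [simp]: "(mat c ** A) $ i $ j = c * A $ i $ j" for A :: "complex^3^3"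
proof -
  have "(mat c ** A) $ i $ j = (\<Sum>k\<in>UNIV. (if i = k then c else 0) * A $ k $ j)"
    by (simp add: mat_def matrix_matrix_mult_def)
  also have "\<dots> = (\<Sum>k\<in>UNIV. if k = i then c * A $ k $ j else 0)"
    by (rule sum.cong) auto
  finally show ?thesis by simp
qed

lemma mat_mult_mat: "mat c ** mat d = (mat (c * d) :: complex^3^3)"
  by (simp add: vec_eq_iff) (simp add: mat_def)

lemma mat_mult_commute: "A ** (mat c ** B) = mat c ** (A ** B)" for A B :: "complex^3^3"
proof -
  have nth: "(A ** M) $ i $ j = (\<Sum>k\<in>UNIV. A $ i $ k * M $ k $ j)" for M :: "complex^3^3" and i j
    by (simp add: matrix_matrix_mult_def)
  show ?thesis
    by (simp add: vec_eq_iff nth sum_distrib_left mult.left_commute)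
qed

lemma mat_mult_vector: "(mat c ** A) *v v = c *s (A *v v)" for A :: "complex^3^3"
  by (simp add: vec_eq_iff matrix_vector_mult_def sum_distrib_left mult_ac)

lemma sp_relI: "A \<noteq> 0 \<Longrightarrow> c \<noteq> 0 \<Longrightarrow> B = mat c ** A \<Longrightarrow> sp_rel A B"
  by (auto simp: sp_rel_def vec_eq_iff)

lemma part_equivp_sp_rel: "part_equivp sp_rel"
proof (rule part_equivpI)
  have "(mat 1 :: complex^3^3) \<noteq> 0"
    by (simp add: vec_eq_iff mat_def exI[of _ 1])
  then show "\<exists>A. sp_rel A A"
    by (intro exI[of _ "mat 1"] sp_relI[of _ 1]) (auto simp: vec_eq_iff)
  show "symp sp_rel"
  proof (rule sympI)
    fix A B assume "sp_rel A B"
    then obtain c where "B \<noteq> 0" "c \<noteq> 0" "B = mat c ** A"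
      by (auto simp: sp_rel_def)
    then show "sp_rel B A"
      by (intro sp_relI[of _ "inverse c"]) (auto simp: vec_eq_iff)
  qed
  show "transp sp_rel"
  proof (rule transpI)
    fix A B C assume "sp_rel A B" "sp_rel B C"
    then obtain c d where "A \<noteq> 0" "c \<noteq> 0" "d \<noteq> 0" "B = mat c ** A" "C = mat d ** B"
      by (auto simp: sp_rel_def)
    then show "sp_rel A C"
      by (intro sp_relI[of _ "d * c"]) (auto simp: vec_eq_iff)
  qed
qed

quotient_type sp3 = "complex^3^3" / partial: sp_rel
  morphisms rep_sp3 sp3_of
  by (rule part_equivp_sp_rel)

lemma rep_sp3_nonzero: "rep_sp3 S \<noteq> 0"
  using Quotient3_rep_reflp[OF Quotient3_sp3, of S] by (simp add: sp_rel_def)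

lemma sp3_of_rep [simp]: "sp3_of (rep_sp3 S) = S"
  by (rule Quotient3_abs_rep[OF Quotient3_sp3])

lemma sp3_of_eq_iff:
  assumes "A \<noteq> 0" "B \<noteq> 0"
  shows "sp3_of A = sp3_of B \<longleftrightarrow> (\<exists>c. c \<noteq> 0 \<and> B = mat c ** A)"
proof -
  have refl: "sp_rel C C" if "C \<noteq> 0" for C
    using that by (intro sp_relI[of _ 1]) (auto simp: vec_eq_iff)
  have "sp_rel A B \<longleftrightarrow> sp3_of A = sp3_of B"
    using Quotient3_rel[OF Quotient3_sp3, of A B] refl[OF assms(1)] refl[OF assms(2)] by simp
  then show ?thesis
    using assms by (auto simp: sp_rel_def)
qed

lemma sp3_of_scale: "c \<noteq> 0 \<Longrightarrow> A \<noteq> 0 \<Longrightarrow> sp3_of (mat c ** A) = sp3_of A"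
  by (subst eq_commute, subst sp3_of_eq_iff) (auto simp: vec_eq_iff)

lemma rep_sp3_of:
  assumes "A \<noteq> 0"
  obtains c where "c \<noteq> 0" "rep_sp3 (sp3_of A) = mat c ** A"
  using sp3_of_eq_iff[OF assms rep_sp3_nonzero, of "sp3_of A"] by auto

instantiation sp3 :: topological_space
begin

definition open_sp3 :: "sp3 set \<Rightarrow> bool" where
  "open_sp3 U \<longleftrightarrow> open {A. A \<noteq> 0 \<and> sp3_of A \<in> U}"

instance
proof
  have "{A. A \<noteq> 0 \<and> sp3_of A \<in> UNIV} = - {0}" by auto
  then show "open (UNIV :: sp3 set)"
    unfolding open_sp3_def by (simp only: open_Compl closed_singleton)
next
  fix U V :: "sp3 set" assume "open U" "open V"
  then have "open ({A. A \<noteq> 0 \<and> sp3_of A \<in> U} \<inter> {A. A \<noteq> 0 \<and> sp3_of A \<in> V})"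
    unfolding open_sp3_def by (rule open_Int)
  also have "{A. A \<noteq> 0 \<and> sp3_of A \<in> U} \<inter> {A. A \<noteq> 0 \<and> sp3_of A \<in> V}
      = {A. A \<noteq> 0 \<and> sp3_of A \<in> U \<inter> V}" by auto
  finally show "open (U \<inter> V)"
    unfolding open_sp3_def .
next
  fix K :: "sp3 set set" assume "\<forall>U\<in>K. open U"
  then have "open (\<Union>U\<in>K. {A. A \<noteq> 0 \<and> sp3_of A \<in> U})"
    unfolding open_sp3_def by (intro open_UN)
  also have "(\<Union>U\<in>K. {A. A \<noteq> 0 \<and> sp3_of A \<in> U}) = {A. A \<noteq> 0 \<and> sp3_of A \<in> \<Union>K}" by auto
  finally show "open (\<Union>K)"
    unfolding open_sp3_def .
qed

end

definition sp_rank :: "sp3 \<Rightarrow> nat" where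
  "sp_rank S = rank (rep_sp3 S)"

definition PSL3 :: "sp3 monoid" where
  "PSL3 = \<lparr>carrier = {sp3_of A | A. det A = 1},
           mult = (\<lambda>S T. sp3_of (rep_sp3 S ** rep_sp3 T)),
           one = sp3_of (mat 1)\<rparr>"

lemma matrix_inv_det:
  fixes A :: "complex^3^3"
  assumes "det A \<noteq> 0"
  shows "A ** matrix_inv A = mat 1" "matrix_inv A ** A = mat 1" "det (matrix_inv A) = inverse (det A)"
proof -
  have "\<exists>B. A ** B = mat 1 \<and> B ** A = mat 1"
    using assms by (simp add: invertible_det_nz[symmetric] invertible_def)
  from someI_ex[OF this] show inv: "A ** matrix_inv A = mat 1" "matrix_inv A ** A = mat 1"
    by (simp_all add: matrix_inv_def)
  have "det A * det (matrix_inv A) = 1"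
    using inv(1) by (metis det_mul det_I)
  then show "det (matrix_inv A) = inverse (det A)"
    by (rule inverse_unique[symmetric])
qed

lemma matrix_inv_eqI:
  fixes A B :: "complex^3^3"
  assumes "A ** B = mat 1"
  shows "matrix_inv A = B"
proof -
  have "det A * det B = 1" using assms by (metis det_mul det_I)
  then have "det A \<noteq> 0" by auto
  then have "matrix_inv A = matrix_inv A ** (A ** B)" using assms by simp
  also have "\<dots> = B" using matrix_inv_det(2)[OF \<open>det A \<noteq> 0\<close>] by (simp add: matrix_mul_assoc)
  finally show ?thesis .
qed

lemma det_nonzero_imp: "det A \<noteq> 0 \<Longrightarrow> A \<noteq> 0" for A :: "complex^3^3"
  using det_0[where 'a=complex and 'n=3] by (auto simp: mat_0)

lemma det_mat_mult: "det (mat c ** A) = c ^ 3 * det A" for A :: "complex^3^3"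
  by (simp only: det_3 mat_mult_nth) (simp add: power3_eq_cube algebra_simps)

lemma PSL3_mult:
  assumes "det A \<noteq> 0" "det B \<noteq> 0"
  shows "sp3_of A \<otimes>\<^bsub>PSL3\<^esub> sp3_of B = sp3_of (A ** B)"
proof -
  obtain c where c: "c \<noteq> 0" "rep_sp3 (sp3_of A) = mat c ** A"
    using rep_sp3_of det_nonzero_imp[OF assms(1)] by blast
  obtain d where d: "d \<noteq> 0" "rep_sp3 (sp3_of B) = mat d ** B"
    using rep_sp3_of det_nonzero_imp[OF assms(2)] by blast
  have AB: "det (A ** B) \<noteq> 0"
    using assms by (simp add: det_mul)
  have "(mat c ** A) ** (mat d ** B) = mat (d * c) ** (A ** B)"
    unfolding mat_mult_commute[of "mat c ** A"] matrix_mul_assoc[of "mat c" A B, symmetric]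
    by (simp add: vec_eq_iff mult.assoc)
  then show ?thesis
    using c d sp3_of_scale[of "d * c", OF _ det_nonzero_imp[OF AB]] by (simp add: PSL3_def)
qed

lemma carrier_PSL3: "carrier PSL3 = {sp3_of A | A. det A = 1}"
  by (simp add: PSL3_def)

lemma one_PSL3: "\<one>\<^bsub>PSL3\<^esub> = sp3_of (mat 1)"
  by (simp add: PSL3_def)

lemma group_PSL3: "group PSL3"
proof (rule groupI)
  show "\<one>\<^bsub>PSL3\<^esub> \<in> carrier PSL3"
    by (auto simp: carrier_PSL3 one_PSL3 intro!: exI[of _ "mat 1"])
next
  fix x y assume "x \<in> carrier PSL3" "y \<in> carrier PSL3"
  then obtain A B where "x = sp3_of A" "y = sp3_of B" "det A = 1" "det B = 1"
    by (auto simp: carrier_PSL3)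
  then show "x \<otimes>\<^bsub>PSL3\<^esub> y \<in> carrier PSL3"
    by (auto simp: PSL3_mult carrier_PSL3 det_mul intro!: exI[of _ "A ** B"])
next
  fix x y z assume "x \<in> carrier PSL3" "y \<in> carrier PSL3" "z \<in> carrier PSL3"
  then obtain A B C where "x = sp3_of A" "y = sp3_of B" "z = sp3_of C"
    "det A = 1" "det B = 1" "det C = 1"
    by (auto simp: carrier_PSL3)
  then show "x \<otimes>\<^bsub>PSL3\<^esub> y \<otimes>\<^bsub>PSL3\<^esub> z = x \<otimes>\<^bsub>PSL3\<^esub> (y \<otimes>\<^bsub>PSL3\<^esub> z)"
    by (simp add: PSL3_mult det_mul matrix_mul_assoc)
next
  fix x assume "x \<in> carrier PSL3"
  then obtain A where A: "x = sp3_of A" "det A = 1"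
    by (auto simp: carrier_PSL3)
  then show "\<one>\<^bsub>PSL3\<^esub> \<otimes>\<^bsub>PSL3\<^esub> x = x"
    by (simp add: one_PSL3 PSL3_mult)
  have inv: "matrix_inv A ** A = mat 1" "det (matrix_inv A) = 1"
    using A matrix_inv_det[of A] by simp_all
  with A inv show "\<exists>y\<in>carrier PSL3. y \<otimes>\<^bsub>PSL3\<^esub> x = \<one>\<^bsub>PSL3\<^esub>"
    by (intro bexI[of _ "sp3_of (matrix_inv A)"])
       (auto simp: PSL3_mult one_PSL3 carrier_PSL3 intro!: exI[of _ "matrix_inv A"])
qed

definition psl_act :: "sp3 \<Rightarrow> cp2 \<Rightarrow> cp2" where
  "psl_act g x = cp2_of (rep_sp3 g *v rep_cp2 x)"

definition contragredient :: "sp3 \<Rightarrow> sp3" where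
  "contragredient g = sp3_of (transpose (matrix_inv (rep_sp3 g)))"

lemma det_nonzero_mult_vector: "det A \<noteq> 0 \<Longrightarrow> v \<noteq> 0 \<Longrightarrow> A *v v \<noteq> 0" for A :: "complex^3^3"
  by (metis matrix_inv_det(2) matrix_vector_mul_assoc matrix_vector_mul_lid
      matrix_vector_mult_0_right)

lemma psl_act_sp3_of:
  assumes "det A \<noteq> 0" "v \<noteq> 0"
  shows "psl_act (sp3_of A) (cp2_of v) = cp2_of (A *v v)"
proof -
  obtain c where c: "c \<noteq> 0" "rep_sp3 (sp3_of A) = mat c ** A"
    using rep_sp3_of det_nonzero_imp[OF assms(1)] by blast
  obtain d where d: "d \<noteq> 0" "rep_cp2 (cp2_of v) = d *s v"
    using rep_cp2_of[OF assms(2)] .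
  have "rep_sp3 (sp3_of A) *v rep_cp2 (cp2_of v) = (c * d) *s (A *v v)"
    by (simp add: c d mat_mult_vector vec.scale mult_ac)
  moreover have "A *v v \<noteq> 0"
    using assms by (rule det_nonzero_mult_vector)
  moreover have "cp2_of (A *v v) = cp2_of ((c * d) *s (A *v v))"
    using c d \<open>A *v v \<noteq> 0\<close> by (subst cp2_of_eq_iff) auto
  ultimately show ?thesis
    by (simp add: psl_act_def)
qed

lemma contragredient_sp3_of:
  assumes "det A \<noteq> 0"
  shows "contragredient (sp3_of A) = sp3_of (transpose (matrix_inv A))"
proof -
  obtain c where c: "c \<noteq> 0" "rep_sp3 (sp3_of A) = mat c ** A"
    using rep_sp3_of det_nonzero_imp[OF assms] by blast
  have "(mat c ** A) ** (mat (inverse c) ** matrix_inv A) = mat (inverse c) ** (mat c ** mat 1)"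
    unfolding mat_mult_commute[of "mat c ** A"] matrix_mul_assoc[of "mat c" A "matrix_inv A", symmetric] matrix_inv_det(1)[OF assms]
    by (rule refl)
  also have "\<dots> = mat 1"
    using c(1) by (simp add: mat_mult_mat)
  finally have "matrix_inv (mat c ** A) = mat (inverse c) ** matrix_inv A"
    by (rule matrix_inv_eqI)
  then have "transpose (matrix_inv (rep_sp3 (sp3_of A))) = mat (inverse c) ** transpose (matrix_inv A)"
    unfolding c(2) by (simp add: vec_eq_iff transpose_def)
  moreover have "transpose (matrix_inv A) \<noteq> 0"
    using matrix_inv_det(3)[OF assms] assms by (intro det_nonzero_imp) (simp add: det_transpose)
  ultimately show ?thesis
    unfolding contragredient_def using c sp3_of_scale[of "inverse c"] by simp
qed

text \<open>The contragredient action is the action on lines.\<close>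

lemma line_of_contragredient:
  assumes "g \<in> carrier PSL3"
  shows "line_of (psl_act (contragredient g) l) = psl_act g ` line_of l"
proof -
  from assms obtain A where A: "g = sp3_of A" "det A = 1"
    by (auto simp: carrier_PSL3)
  let ?B = "matrix_inv A" and ?f = "rep_cp2 l"
  have B: "A ** ?B = mat 1" "?B ** A = mat 1" "det ?B = 1"
    using A matrix_inv_det[of A] by simp_all
  have dual: "psl_act (contragredient g) l = cp2_of (transpose ?B *v ?f)"
    using psl_act_sp3_of[of "transpose ?B" ?f] A B
    by (simp add: contragredient_sp3_of det_transpose rep_cp2_nonzero)
  have "transpose ?B *v ?f \<noteq> 0"
    using B by (intro det_nonzero_mult_vector) (auto simp: det_transpose rep_cp2_nonzero)
  then have iff: "incident p (psl_act (contragredient g) l) \<longleftrightarrow> incident (psl_act (sp3_of ?B) p) l" for p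
  proof -
    have "(\<Sum>i\<in>UNIV. (transpose ?B *v ?f) $ i * rep_cp2 p $ i)
        = (\<Sum>i\<in>UNIV. ?f $ i * (?B *v rep_cp2 p) $ i)"
      by (simp add: sum_3 matrix_vector_mult_def transpose_def algebra_simps)
    moreover have "psl_act (sp3_of ?B) p = cp2_of (?B *v rep_cp2 p)"
      using psl_act_sp3_of[of ?B "rep_cp2 p"] B by (simp add: rep_cp2_nonzero)
    moreover have "?B *v rep_cp2 p \<noteq> 0"
      using B by (intro det_nonzero_mult_vector) (auto simp: rep_cp2_nonzero)
    ultimately show ?thesis
      using incident_cp2_of[of "rep_cp2 p" "transpose ?B *v ?f"] incident_cp2_of[of "?B *v rep_cp2 p" ?f]
        \<open>transpose ?B *v ?f \<noteq> 0\<close> by (simp add: dual rep_cp2_nonzero)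
  qed
  have inv: "psl_act (sp3_of C) (psl_act (sp3_of D) p) = p" if "C ** D = mat 1" "det C = 1" "det D = 1" for C D p
  proof -
    have "psl_act (sp3_of D) p = cp2_of (D *v rep_cp2 p)"
      using psl_act_sp3_of[of D "rep_cp2 p"] that by (simp add: rep_cp2_nonzero)
    moreover have "D *v rep_cp2 p \<noteq> 0"
      using that by (intro det_nonzero_mult_vector) (auto simp: rep_cp2_nonzero)
    ultimately show ?thesis
      using psl_act_sp3_of[of C "D *v rep_cp2 p"] that by (simp add: matrix_vector_mul_assoc)
  qed
  show ?thesis
  proof (intro Set.set_eqI iffI)
    fix p assume "p \<in> line_of (psl_act (contragredient g) l)"
    then have "psl_act (sp3_of ?B) p \<in> line_of l" by (simp add: line_of_def iff)
    moreover have "p = psl_act g (psl_act (sp3_of ?B) p)"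
      using inv[OF B(1) A(2) B(3)] unfolding A(1) by (rule sym)
    ultimately show "p \<in> psl_act g ` line_of l" by blast
  next
    fix p assume "p \<in> psl_act g ` line_of l"
    then obtain q where q: "q \<in> line_of l" "p = psl_act g q" by blast
    have "psl_act (sp3_of ?B) p = q" using inv[OF B(2,3) A(2)] unfolding q(2) A(1) .
    then show "p \<in> line_of (psl_act (contragredient g) l)"
      using q(1) unfolding line_of_def by (simp only: mem_Collect_eq iff)
  qed
qed


section \<open>Cartan projection and the flag limit set\<close>

definition SU3 :: "(complex^3^3) set" where
  "SU3 = {k. k ** (\<chi> i j. cnj (k $ j $ i)) = mat 1 \<and> det k = 1}"

definition exp_diag :: "real^3 \<Rightarrow> complex^3^3" where
  "exp_diag l = (\<chi> i j. if i = j then of_real (exp (l $ i)) else 0)"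

definition cartan_decomp :: "sp3 \<Rightarrow> complex^3^3 \<Rightarrow> real^3 \<Rightarrow> complex^3^3 \<Rightarrow> bool" where
  "cartan_decomp g k1 l k2 \<longleftrightarrow>
     k1 \<in> SU3 \<and> k2 \<in> SU3 \<and> l $ 1 \<ge> l $ 2 \<and> l $ 2 \<ge> l $ 3 \<and> l $ 1 + l $ 2 + l $ 3 = 0 \<and>
     g = sp3_of (k1 ** exp_diag l ** k2)"

definition cartan_proj :: "sp3 \<Rightarrow> real^3" where
  "cartan_proj g = (THE l. \<exists>k1 k2. cartan_decomp g k1 l k2)"

definition gap1 :: "sp3 \<Rightarrow> real" where
  "gap1 g = cartan_proj g $ 1 - cartan_proj g $ 2"

definition gap2 :: "sp3 \<Rightarrow> real" where
  "gap2 g = cartan_proj g $ 2 - cartan_proj g $ 3"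

definition theta_divergent :: "sp3 set \<Rightarrow> bool" where
  "theta_divergent G \<longleftrightarrow>
     (\<forall>g :: nat \<Rightarrow> sp3. inj g \<and> range g \<subseteq> G \<longrightarrow>
        filterlim (\<lambda>n. gap1 (g n)) at_top sequentially \<and>
        filterlim (\<lambda>n. gap2 (g n)) at_top sequentially)"

text \<open>The line spanned by \<open>e\<^sub>1\<close> and \<open>e\<^sub>2\<close> is the zero set of the third coordinate.\<close>

definition standard_flag :: "cp2 \<times> dual_cp2" where
  "standard_flag = (cp2_of (axis 1 1), cp2_of (axis 3 1))"

definition flag_act :: "sp3 \<Rightarrow> cp2 \<times> dual_cp2 \<Rightarrow> cp2 \<times> dual_cp2" where
  "flag_act g F = (psl_act g (fst F), psl_act (contragredient g) (snd F))"

text \<open>Only meaningful for elements with positive gaps, where the flag does not depend on \<open>k1\<close>.\<close>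

definition left_singular_flag :: "sp3 \<Rightarrow> cp2 \<times> dual_cp2" where
  "left_singular_flag g =
     (THE F. \<exists>k1 l k2. cartan_decomp g k1 l k2 \<and> F = flag_act (sp3_of k1) standard_flag)"

definition flag_limit_set :: "sp3 set \<Rightarrow> (cp2 \<times> dual_cp2) set" where
  "flag_limit_set G =
     {F \<in> flags. \<exists>g :: nat \<Rightarrow> sp3. inj g \<and> range g \<subseteq> G \<and> (\<lambda>n. left_singular_flag (g n)) \<longlonglongrightarrow> F}"

definition Th_inc :: "(cp2 \<times> dual_cp2) set \<Rightarrow> cp2 set" where
  "Th_inc L = (\<Union>(p, l)\<in>L. line_of l)"


section \<open>Limit sets of groups acting on the projective plane\<close>

definition SP_boundary :: "sp3 set \<Rightarrow> sp3 set" where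
  "SP_boundary G = {S. \<exists>g :: nat \<Rightarrow> sp3. inj g \<and> range g \<subseteq> G \<and> g \<longlonglongrightarrow> S}"

definition CoG_limit_set :: "sp3 set \<Rightarrow> dual_cp2 set" where
  "CoG_limit_set G =
     {l. \<exists>g :: nat \<Rightarrow> sp3. inj g \<and> range g \<subseteq> G \<and>
        (\<exists>U. open U \<and> U \<noteq> {} \<and> (\<forall>x\<in>U. (\<lambda>n. psl_act (contragredient (g n)) x) \<longlonglongrightarrow> l))}"

text \<open>
  The plane is compact, so equicontinuity does not depend on the choice of a compatible metric.
\<close>

definition equicontinuous_at :: "sp3 set \<Rightarrow> cp2 \<Rightarrow> bool" where
  "equicontinuous_at G x \<longleftrightarrow>
     (\<forall>e>0. \<exists>d>0. \<forall>g\<in>G. \<forall>y. dist y x < d \<longrightarrow> dist (psl_act g y) (psl_act g x) < e)"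

definition Eq_set :: "sp3 set \<Rightarrow> cp2 set" where
  "Eq_set G = {x. \<exists>U. open U \<and> x \<in> U \<and> (\<forall>y\<in>U. equicontinuous_at G y)}"

definition Myrberg_set :: "sp3 set \<Rightarrow> cp2 set" where
  "Myrberg_set G = - Eq_set G"

definition properly_discontinuous_on :: "sp3 set \<Rightarrow> cp2 set \<Rightarrow> bool" where
  "properly_discontinuous_on G X \<longleftrightarrow>
     (\<forall>g\<in>G. psl_act g ` X \<subseteq> X) \<and>
     (\<forall>K. compact K \<and> K \<subseteq> X \<longrightarrow> finite {g \<in> G. psl_act g ` K \<inter> K \<noteq> {}})"

definition Kul_L0 :: "sp3 set \<Rightarrow> cp2 set" where
  "Kul_L0 G = closure {z. infinite {g \<in> G. psl_act g z = z}}"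

definition Kul_L1 :: "sp3 set \<Rightarrow> cp2 set" where
  "Kul_L1 G = closure {y. \<exists>z. z \<notin> Kul_L0 G \<and> y islimpt ((\<lambda>g. psl_act g z) ` G)}"

text \<open>
  A point accumulates at the family \<open>{g(K)}\<close> if each of its neighbourhoods meets \<open>g(K)\<close>
  for infinitely many \<open>g\<close>.
\<close>

definition Kul_L2 :: "sp3 set \<Rightarrow> cp2 set" where
  "Kul_L2 G =
     closure {y. \<exists>K. compact K \<and> K \<inter> (Kul_L0 G \<union> Kul_L1 G) = {} \<and>
       (\<forall>U. open U \<and> y \<in> U \<longrightarrow> infinite {g \<in> G. psl_act g ` K \<inter> U \<noteq> {}})}"

definition Kul_limit_set :: "sp3 set \<Rightarrow> cp2 set" where
  "Kul_limit_set G = Kul_L0 G \<union> Kul_L1 G \<union> Kul_L2 G"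

definition Kul_region :: "sp3 set \<Rightarrow> cp2 set" where
  "Kul_region G = - Kul_limit_set G"

end

theory Submission
  imports Defs
begin

text \<open>
  Writing \<open>g\<^sub>n = k\<^sub>n a\<^sub>n m\<^sub>n\<close> and passing to a subsequence with \<open>k\<^sub>n \<rightarrow> k\<close> and \<open>m\<^sub>n \<rightarrow> m\<close>, divergence of
  both gaps makes suitably rescaled lifts of \<open>g\<^sub>n\<close>, of \<open>g\<^sub>n\<^sup>-\<^sup>1\<close> and of the contragredient of \<open>g\<^sub>n\<close>
  converge to matrices of rank one. Off the kernel of such a limit the maps converge locally
  uniformly to a constant, and all the kernels and images that occur are members of limit flags:
  if \<open>(p, l)\<close> and \<open>(q, m)\<close> are the limits of the singular flags of \<open>g\<^sub>n\<close> and \<open>g\<^sub>n\<^sup>-\<^sup>1\<close>, then \<open>g\<^sub>n\<close>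
  tends to \<open>p\<close> off the line \<open>m\<close>, \<open>g\<^sub>n\<^sup>-\<^sup>1\<close> tends to \<open>q\<close> off \<open>l\<close>, and \<open>g\<^sub>n\<close> moves every line not through
  \<open>q\<close> to \<open>l\<close>. Normality, proper discontinuity and the inclusions between the Kulkarni and the
  Myrberg limit set follow from these convergence statements.
\<close>

section \<open>Singular value decomposition in dimension three\<close>

text \<open>Cartan exponents and singular flags are definite descriptions, so no sequence can be
  analysed before decompositions exist, have a unique exponent vector and, for strict gaps, have
  columns unique up to scalars. Existence comes from maximising norms on spheres, uniqueness from
  the eigenvalues of \<open>A ** adjoint3 A\<close>, which forgets the right factor.

  Closure of the group under inverses puts the repelling line of a sequence into the same limit set
  as its attracting flag. Hence a point off all limit lines is attracted along a subsequence of any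
  sequence of distinct elements.

  Failure of equicontinuity or of finiteness only yields infinitely many elements at each scale; a
  recursive choice turns these into sequences of distinct elements. Singular flags are not strictly
  equivariant, so invariance of the union of limit lines is derived from equicontinuity.

  The three lines of the Kulkarni part serve to avoid one point: lines through the repelling point
  \<open>q\<close> need not be carried to \<open>l\<close>, but of three lines without a common
  point one misses \<open>q\<close>.\<close>

definition hdot :: "complex^3 \<Rightarrow> complex^3 \<Rightarrow> complex" where
  "hdot v w = (\<Sum>i\<in>UNIV. v $ i * cnj (w $ i))"

text \<open>The conjugates make the cross product orthogonal to both arguments for the Hermitian
  form \<open>hdot\<close>, rather than for the bilinear one.\<close>

definition ccross :: "complex^3 \<Rightarrow> complex^3 \<Rightarrow> complex^3" where
  "ccross v w = vector [cnj (v $ 2 * w $ 3 - v $ 3 * w $ 2), cnj (v $ 3 * w $ 1 - v $ 1 * w $ 3),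
     cnj (v $ 1 * w $ 2 - v $ 2 * w $ 1)]"

definition cols3 :: "complex^3 \<Rightarrow> complex^3 \<Rightarrow> complex^3 \<Rightarrow> complex^3^3" where
  "cols3 a b c = (\<chi> i j. if j = 1 then a $ i else if j = 2 then b $ i else c $ i)"

definition adjoint3 :: "complex^3^3 \<Rightarrow> complex^3^3" where
  "adjoint3 A = (\<chi> i j. cnj (A $ j $ i))"

definition cnj_mat :: "complex^3^3 \<Rightarrow> complex^3^3" where
  "cnj_mat A = (\<chi> i j. cnj (A $ i $ j))"

lemma hdot_3: "hdot v w = v $ 1 * cnj (w $ 1) + v $ 2 * cnj (w $ 2) + v $ 3 * cnj (w $ 3)"
  by (simp add: hdot_def sum_3)

lemma hdot_self: "hdot v v = of_real ((norm v)\<^sup>2)"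
  by (simp only: hdot_def norm_cvec_sq)

lemma hdot_self_eq_1_iff: "hdot v v = 1 \<longleftrightarrow> norm v = 1"
proof -
  have "hdot v v = 1 \<longleftrightarrow> (norm v)\<^sup>2 = 1"
    unfolding hdot_self by (metis of_real_eq_1_iff)
  also have "\<dots> \<longleftrightarrow> norm v = 1"
    by (simp add: power2_eq_1_iff) (metis norm_ge_zero le_minus_one_simps(3))
  finally show ?thesis .
qed

lemma hdot_add_left: "hdot (u + v) w = hdot u w + hdot v w"
  and hdot_add_right: "hdot u (v + w) = hdot u v + hdot u w"
  and hdot_smult_left: "hdot (c *s v) w = c * hdot v w"
  and hdot_smult_right: "hdot v (c *s w) = cnj c * hdot v w"
  and hdot_cnj: "cnj (hdot v w) = hdot w v"
  by (simp_all add: hdot_3 algebra_simps)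

lemma hdot_ccross: "hdot v (ccross v w) = 0" "hdot w (ccross v w) = 0"
  by (simp_all add: hdot_3 ccross_def vector_3 algebra_simps)

text \<open>Lagrange's identity; for an orthonormal pair it shows that the third frame vector has
  length one.\<close>

lemma hdot_ccross_self:
  "hdot (ccross v w) (ccross v w) = hdot v v * hdot w w - hdot v w * hdot w v"
  by (simp add: hdot_3 ccross_def vector_3 algebra_simps)

text \<open>A triple product. It makes the determinant of a frame completed by \<open>ccross\<close>
  equal to one, not merely of modulus one.\<close>

lemma det_cols3_ccross: "det (cols3 a b (ccross a b)) = hdot (ccross a b) (ccross a b)"
  by (simp add: det_3 cols3_def hdot_3 ccross_def vector_3 algebra_simps)

lemma SU3_iff: "k \<in> SU3 \<longleftrightarrow> k ** adjoint3 k = mat 1 \<and> det k = 1"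
  by (simp add: SU3_def adjoint3_def)

lemma cols3_in_SU3:
  assumes "hdot a a = 1" "hdot b b = 1" "hdot a b = 0"
  shows "cols3 a b (ccross a b) \<in> SU3"
proof -
  let ?U = "cols3 a b (ccross a b)"
  have ba: "hdot b a = 0"
    using hdot_cnj[of a b] assms(3) by simp
  have cc: "hdot (ccross a b) (ccross a b) = 1"
    by (simp add: hdot_ccross_self assms ba)
  have c: "hdot (ccross a b) a = 0" "hdot (ccross a b) b = 0"
    using hdot_cnj[of a "ccross a b"] hdot_cnj[of b "ccross a b"] by (simp_all add: hdot_ccross)
  have "(adjoint3 ?U ** ?U) $ i $ j = (mat 1 :: complex^3^3) $ i $ j" for i j
  proof -
    have "(adjoint3 ?U ** ?U) $ i $ j = hdot (column j ?U) (column i ?U)"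
      by (simp add: matrix_matrix_mult_def adjoint3_def hdot_def column_def mult.commute)
    moreover have "column 1 ?U = a" "column 2 ?U = b" "column 3 ?U = ccross a b"
      by (simp_all add: column_def cols3_def)
    ultimately show ?thesis
      using exhaust_3[of i] exhaust_3[of j] assms ba cc c hdot_ccross[of a b] hdot_ccross[of b a]
      by (auto simp: mat_def)
  qed
  then have "adjoint3 ?U ** ?U = mat 1"
    by (simp add: vec_eq_iff)
  then have "?U ** adjoint3 ?U = mat 1"
    by (simp add: matrix_left_right_inverse)
  then show ?thesis
    by (simp add: SU3_iff det_cols3_ccross cc)
qed

lemma norm_vec_add_sq:
  "(norm (v + w))\<^sup>2 = (norm v)\<^sup>2 + 2 * Re (hdot w v) + (norm w)\<^sup>2" for v w :: "complex^3"
proof -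
  have "complex_of_real ((norm (v + w))\<^sup>2) = hdot v v + (hdot w v + cnj (hdot w v)) + hdot w w"
    unfolding hdot_self[symmetric] hdot_cnj by (simp add: hdot_add_left hdot_add_right)
  also have "\<dots> = of_real ((norm v)\<^sup>2 + 2 * Re (hdot w v) + (norm w)\<^sup>2)"
    by (simp only: hdot_self complex_add_cnj of_real_add)
  finally show ?thesis by (simp only: of_real_eq_iff)
qed

lemma complex_vec_perp_exists: "\<exists>w :: complex^3. norm w = 1 \<and> hdot w v = 0"
proof -
  obtain w :: "complex^3" where w: "w \<noteq> 0" "hdot w v = 0"
  proof (cases "v $ 1 = 0")
    case True
    then have "hdot (axis 1 1) v = 0" by (simp add: hdot_3 axis_def)
    then show ?thesis using that[of "axis 1 1"] by (simp add: axis_eq_0_iff)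
  next
    case False
    let ?w = "vector [- cnj (v $ 2), cnj (v $ 1), 0] :: complex^3"
    have "?w $ 2 \<noteq> 0" using False by (simp add: vector_3)
    then have "?w \<noteq> 0" by (metis zero_index)
    moreover have "hdot ?w v = 0" by (simp add: hdot_3 vector_3)
    ultimately show ?thesis using that by blast
  qed
  then show ?thesis
    by (intro exI[of _ "of_real (inverse (norm w)) *s w"])
       (simp add: norm_cvec_smult hdot_smult_left del: of_real_inverse)
qed

text \<open>First variation at a maximiser: since \<open>w\<close> is orthogonal to
  \<open>v\<close>, the norm of the perturbed vector changes only at second order, so the
  first-order change of the norm of its image must vanish.\<close>

lemma maximizer_perp:
  fixes A :: "complex^3^3"
  assumes v: "norm v = 1" and w: "hdot w v = 0"
    and max: "\<And>c. norm (A *v (v + c *s w)) \<le> norm (A *v v) * norm (v + c *s w)"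
  shows "hdot (A *v w) (A *v v) = 0"
proof -
  let ?h = "hdot (A *v w) (A *v v)" and ?s = "norm (A *v v)"
  have ineq: "2 * t * (cmod ?h)\<^sup>2 \<le> t\<^sup>2 * ((cmod ?h)\<^sup>2 * ?s\<^sup>2 * (norm w)\<^sup>2)" for t :: real
  proof -
    \<comment> \<open>This phase turns the cross term into \<open>t\<close> times the squared
      modulus of \<open>?h\<close>, a real quantity linear in \<open>t\<close>.\<close>
    let ?c = "of_real t * cnj ?h"
    have 1: "(norm (A *v (v + ?c *s w)))\<^sup>2 \<le> (?s * norm (v + ?c *s w))\<^sup>2"
      by (intro power_mono max) simp
    have 2: "(norm (A *v (v + ?c *s w)))\<^sup>2
        = ?s\<^sup>2 + 2 * Re (?c * ?h) + (norm (?c *s (A *v w)))\<^sup>2"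
      by (simp only: matrix_vector_right_distrib norm_vec_add_sq vec.scale hdot_smult_left)
    have 3: "(norm (v + ?c *s w))\<^sup>2 = 1 + (t * cmod ?h * norm w)\<^sup>2"
      by (simp add: norm_vec_add_sq hdot_smult_left v w norm_cvec_smult norm_mult power_mult_distrib)
    have 4: "Re (?c * ?h) = t * (cmod ?h)\<^sup>2"
    proof -
      have "?c * ?h = of_real (t * (cmod ?h)\<^sup>2)"
        unfolding of_real_mult complex_norm_square by (simp only: mult_ac)
      then show ?thesis by (simp only: Re_complex_of_real)
    qed
    have 5: "(norm (?c *s (A *v w)))\<^sup>2 \<ge> 0" by simp
    have "?s\<^sup>2 + 2 * (t * (cmod ?h)\<^sup>2) \<le> ?s\<^sup>2 * (1 + (t * cmod ?h * norm w)\<^sup>2)"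
      using 1[unfolded power_mult_distrib[of ?s] 2 3 4] 5 by linarith
    then show ?thesis
      by (simp add: power_mult_distrib algebra_simps)
  qed
  show ?thesis
  proof (rule ccontr)
    assume "?h \<noteq> 0"
    then have h: "(cmod ?h)\<^sup>2 > 0" by simp
    define b where "b = ?s\<^sup>2 * (norm w)\<^sup>2"
    have b: "b \<ge> 0" by (simp add: b_def)
    have tb: "2 * t \<le> t\<^sup>2 * b" for t
    proof -
      have "(cmod ?h)\<^sup>2 * (2 * t) \<le> (cmod ?h)\<^sup>2 * (t\<^sup>2 * b)"
        using ineq[of t] by (simp add: b_def mult_ac)
      then show ?thesis using h by (simp only: mult_le_cancel_left_pos)
    qed
    \<comment> \<open>Any positive \<open>t\<close> with \<open>t * b < 2\<close> refutes the
      inequality; the summand 1 covers \<open>b = 0\<close>.\<close>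
    define t where "t = 1 / (1 + b)"
    have "2 * t \<le> t * (t * b)" using tb[of t] by (simp add: power2_eq_square mult.assoc)
    moreover have "t > 0" "t * b \<le> 1" using b by (simp_all add: t_def)
    then have "t * (t * b) \<le> t * 1" by (intro mult_left_mono) auto
    ultimately show False using \<open>t > 0\<close> by simp
  qed
qed

lemma sphere_maximizer:
  fixes A :: "complex^3^3"
  assumes "closed W" "\<exists>w\<in>W. norm w = 1"
  obtains v where "v \<in> W" "norm v = 1" "\<And>w. w \<in> W \<Longrightarrow> norm w = 1 \<Longrightarrow> norm (A *v w) \<le> norm (A *v v)"
proof -
  have "compact (sphere 0 1 \<inter> W)"
    using assms(1) by (intro compact_Int_closed) auto
  moreover have "continuous_on (sphere 0 1 \<inter> W) (\<lambda>v. norm (A *v v))"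
    by (intro continuous_intros)
  moreover have "sphere 0 1 \<inter> W \<noteq> {}" using assms(2) by auto
  ultimately obtain v where "v \<in> sphere 0 1 \<inter> W" "\<forall>w\<in>sphere 0 1 \<inter> W. norm (A *v w) \<le> norm (A *v v)"
    using continuous_attains_sup by metis
  then show ?thesis by (intro that[of v]) auto
qed

lemma norm_mult_le_of_sphere:
  fixes A :: "complex^3^3"
  assumes "\<And>c w. w \<in> W \<Longrightarrow> c *s w \<in> W" "w \<in> W"
    and "\<And>w. w \<in> W \<Longrightarrow> norm w = 1 \<Longrightarrow> norm (A *v w) \<le> s"
  shows "norm (A *v w) \<le> s * norm w"
proof (cases "w = 0")
  case False
  let ?c = "complex_of_real (inverse (norm w))"
  have "norm (?c *s w) = 1" using False by (simp add: norm_cvec_smult del: of_real_inverse)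
  then have "norm (A *v (?c *s w)) \<le> s" using assms by blast
  then have "inverse (norm w) * norm (A *v w) \<le> s"
    by (simp add: vec.scale norm_cvec_smult del: of_real_inverse)
  then show ?thesis using False by (simp add: field_simps)
qed simp

lemma adjoint3_in_SU3:
  assumes "k \<in> SU3" shows "adjoint3 k \<in> SU3"
proof -
  have "adjoint3 (adjoint3 k) = k" by (simp add: adjoint3_def vec_eq_iff)
  moreover have "adjoint3 k ** k = mat 1"
    using assms by (simp add: SU3_iff matrix_left_right_inverse)
  moreover have "det (adjoint3 k) = cnj (det k)"
    by (simp add: det_3 adjoint3_def algebra_simps)
  ultimately show ?thesis using assms by (simp add: SU3_iff)
qed

lemma inner_hdot: "inner v w = Re (hdot v w)"
  by (simp add: hdot_def inner_vec_def inner_complex_def)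

text \<open>These are the entries of the matrix of \<open>A\<close> with respect to the column
  frames \<open>V\<close> (source) and \<open>U\<close> (target).\<close>

lemma adjoint_cols3_conj_nth:
  "(adjoint3 U ** A ** V) $ i $ j = hdot (A *v column j V) (column i U)"
proof -
  have "(adjoint3 U ** (A ** V)) $ i $ j = (\<Sum>k\<in>UNIV. cnj (U $ k $ i) * (A ** V) $ k $ j)"
    by (simp add: matrix_matrix_mult_def adjoint3_def)
  also have "\<dots> = hdot (A *v column j V) (column i U)"
    by (simp add: hdot_def column_def matrix_matrix_mult_def matrix_vector_mult_def mult.commute)
  finally show ?thesis by (simp add: matrix_mul_assoc)
qed

text \<open>Greedy choice of singular vectors: \<open>v1\<close> maximises the norm of the image on
  the whole sphere, \<open>v2\<close> on the part orthogonal to \<open>v1\<close>, and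
  \<open>v3\<close> is then forced. Maximality makes the images orthogonal, so normalised images
  supply the left frame.\<close>

lemma cartan_decomp_exists:
  assumes A: "det A = 1"
  shows "\<exists>k1 l k2. cartan_decomp (sp3_of A) k1 l k2"
proof -
  have pos: "norm (A *v v) > 0" if "norm v = 1" for v
    using that det_nonzero_mult_vector[of A v] A by fastforce
  have "\<exists>w::complex^3. norm w = 1" using complex_vec_perp_exists by blast
  then obtain v1 where v1: "norm v1 = 1" and max1: "\<And>w. norm w = 1 \<Longrightarrow> norm (A *v w) \<le> norm (A *v v1)"
    using sphere_maximizer[of UNIV A] by auto
  define W where "W = {w. hdot w v1 = 0}"
  have "closed W"
    unfolding W_def hdot_def by (intro closed_Collect_eq continuous_intros)
  then obtain v2 where v2: "v2 \<in> W" "norm v2 = 1"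
    and max2: "\<And>w. w \<in> W \<Longrightarrow> norm w = 1 \<Longrightarrow> norm (A *v w) \<le> norm (A *v v2)"
    using sphere_maximizer[of W A] complex_vec_perp_exists[of v1] unfolding W_def by blast
  define v3 where "v3 = ccross v1 v2"
  have v21: "hdot v2 v1 = 0" and v12: "hdot v1 v2 = 0"
    using v2 hdot_cnj[of v2 v1] by (auto simp: W_def)
  have v31: "hdot v3 v1 = 0" and v32: "hdot v3 v2 = 0"
    using hdot_ccross[of v1 v2] hdot_cnj[of v1 v3] hdot_cnj[of v2 v3] hdot_ccross[of v2 v1]
    by (auto simp: v3_def)
  have "hdot v3 v3 = 1"
    unfolding v3_def hdot_ccross_self by (simp add: v12 v1[folded hdot_self_eq_1_iff] v2(2)[folded hdot_self_eq_1_iff])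
  then have nv3: "norm v3 = 1" by (simp only: hdot_self_eq_1_iff)
  define V where "V = cols3 v1 v2 v3"
  have V: "V \<in> SU3"
    unfolding V_def v3_def by (intro cols3_in_SU3) (simp_all add: hdot_self_eq_1_iff v1 v2 v12)
  define s1 s2 where "s1 = norm (A *v v1)" and "s2 = norm (A *v v2)"
  have s: "s1 > 0" "s2 > 0" "s2 \<le> s1"
    using pos v1 v2 max1 by (auto simp: s1_def s2_def)
  have le1: "norm (A *v w) \<le> s1 * norm w" for w
    unfolding s1_def by (rule norm_mult_le_of_sphere[of UNIV]) (auto intro: max1)
  have W_scale: "c *s w \<in> W" if "w \<in> W" for c w
    using that by (simp add: W_def hdot_smult_left)
  have le2: "norm (A *v w) \<le> s2 * norm w" if "w \<in> W" for w
    unfolding s2_def using W_scale that max2 by (rule norm_mult_le_of_sphere)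
  have p1: "hdot (A *v w) (A *v v1) = 0" if "hdot w v1 = 0" for w
    using le1 by (intro maximizer_perp[OF v1 that]) (simp add: s1_def)
  have p2: "hdot (A *v v3) (A *v v2) = 0"
  proof (rule maximizer_perp[OF v2(2) v32])
    fix c have "v2 + c *s v3 \<in> W" using v31 v21 by (simp add: W_def hdot_add_left hdot_smult_left)
    then show "norm (A *v (v2 + c *s v3)) \<le> norm (A *v v2) * norm (v2 + c *s v3)"
      using le2 by (simp add: s2_def)
  qed
  define u1 where "u1 = of_real (inverse s1) *s (A *v v1)"
  define u2 where "u2 = of_real (inverse s2) *s (A *v v2)"
  have Av: "A *v v1 = of_real s1 *s u1" "A *v v2 = of_real s2 *s u2"
    using s by (simp_all add: u1_def u2_def vec_eq_iff)
  have nu: "norm u1 = 1" "norm u2 = 1"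
    using s by (simp_all add: u1_def u2_def norm_cvec_smult s1_def[symmetric] s2_def[symmetric] del: of_real_inverse)
  have u21: "hdot u2 u1 = 0"
    using p1[OF v21] by (simp add: u1_def u2_def hdot_smult_left hdot_smult_right)
  then have u12: "hdot u1 u2 = 0"
    using hdot_cnj[of u2 u1] by simp
  \<comment> \<open>Taking the cross product instead of normalising \<open>A *v v3\<close> gives
    \<open>U\<close> determinant one. The third diagonal entry is then only known to be complex; the
    determinant of \<open>D\<close> identifies it as \<open>1 / (s1 * s2)\<close>.\<close>
  define u3 where "u3 = ccross u1 u2"
  have u13: "hdot u1 u3 = 0" and u23: "hdot u2 u3 = 0"
    by (simp_all add: u3_def hdot_ccross)
  have "hdot u3 u3 = 1"
    unfolding u3_def hdot_ccross_self by (simp add: u12 nu[folded hdot_self_eq_1_iff])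
  then have nu3: "norm u3 = 1" by (simp only: hdot_self_eq_1_iff)
  define U where "U = cols3 u1 u2 u3"
  have U: "U \<in> SU3"
    unfolding U_def u3_def by (intro cols3_in_SU3) (simp_all add: hdot_self_eq_1_iff nu u12)
  define c where "c = hdot (A *v v3) u3"
  define D :: "complex^3^3" where
    "D = (\<chi> i j. if i = j then (if j = 1 then of_real s1 else if j = 2 then of_real s2 else c) else 0)"
  have cols: "column 1 V = v1" "column 2 V = v2" "column 3 V = v3"
    "column 1 U = u1" "column 2 U = u2" "column 3 U = u3"
    by (simp_all add: V_def U_def cols3_def column_def)
  have A3: "hdot (A *v v3) u1 = 0" "hdot (A *v v3) u2 = 0"
    using p1[OF v31] p2 by (simp_all add: u1_def u2_def hdot_smult_right)
  have "(adjoint3 U ** A ** V) $ i $ j = D $ i $ j" for i j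
    unfolding adjoint_cols3_conj_nth D_def using exhaust_3[of i] exhaust_3[of j]
    by (auto simp: cols A3 Av c_def hdot_smult_left u21 u12 u13 u23 nu[folded hdot_self_eq_1_iff])
  then have D: "adjoint3 U ** A ** V = D" by (simp add: vec_eq_iff)
  have "det D = 1"
    using U V A adjoint3_in_SU3[OF U] unfolding D[symmetric] by (simp add: det_mul SU3_iff)
  then have "of_real s1 * of_real s2 * c = 1"
    by (simp add: det_3 D_def)
  then have c: "c = of_real (1 / (s1 * s2))"
    using s by (simp add: field_simps)
  \<comment> \<open>The third singular value is at most \<open>s2\<close> because \<open>v3\<close>
    competes with \<open>v2\<close> in \<open>W\<close>; this gives the last inequality in the
    ordering of the exponents.\<close>
  have "1 / (s1 * s2) = inner (A *v v3) u3"
    unfolding inner_hdot c_def[symmetric] c by simp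
  also have "\<dots> \<le> norm (A *v v3)"
    using norm_cauchy_schwarz[of "A *v v3" u3] nu3 by simp
  also have "\<dots> \<le> s2"
    using le2[of v3] v31 nv3 by (simp add: W_def)
  finally have s3: "1 / (s1 * s2) \<le> s2" .
  define l :: "real^3" where "l = vector [ln s1, ln s2, - ln s1 - ln s2]"
  have l: "l $ 1 = ln s1" "l $ 2 = ln s2" "l $ 3 = ln (1 / (s1 * s2))"
    using s by (simp_all add: l_def ln_div ln_mult)
  have "exp_diag l = D"
    unfolding exp_diag_def D_def c vec_eq_iff using s by (auto simp: forall_3 l)
  moreover have "U ** D ** adjoint3 V = (U ** adjoint3 U) ** A ** (V ** adjoint3 V)"
    unfolding D[symmetric] by (simp add: matrix_mul_assoc)
  then have "U ** D ** adjoint3 V = A"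
    using U V by (simp add: SU3_iff)
  moreover have "l $ 1 \<ge> l $ 2" "l $ 2 \<ge> l $ 3" "l $ 1 + l $ 2 + l $ 3 = 0"
    using s s3 unfolding l by (simp_all add: ln_div ln_mult) (smt (verit) ln_mult ln_div ln_mono ln_one divide_pos_pos mult_pos_pos)+
  ultimately show ?thesis
    unfolding cartan_decomp_def using U adjoint3_in_SU3[OF V] by metis
qed

section \<open>Uniqueness of the Cartan data\<close>

lemma SU3_unitary:
  assumes "k \<in> SU3"
  shows "k ** adjoint3 k = mat 1" "adjoint3 k ** k = mat 1" "matrix_inv k = adjoint3 k" "det k = 1"
  using assms by (simp_all add: SU3_iff matrix_left_right_inverse matrix_inv_eqI)

lemma adjoint3_mult: "adjoint3 (A ** B) = adjoint3 B ** adjoint3 A"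
  by (simp add: adjoint3_def matrix_matrix_mult_def vec_eq_iff mult.commute)

lemma transpose_adjoint3: "transpose (adjoint3 A) = cnj_mat A"
  by (simp add: adjoint3_def cnj_mat_def transpose_def vec_eq_iff)

lemma exp_diag_add: "exp_diag l ** exp_diag l' = exp_diag (l + l')"
  unfolding vec_eq_iff matrix_matrix_mult_def exp_diag_def
  by (auto simp: forall_3 sum_3 exp_add)

lemma exp_diag_0: "exp_diag 0 = mat 1"
  by (simp add: exp_diag_def mat_def vec_eq_iff)

lemma adjoint3_exp_diag: "adjoint3 (exp_diag l) = exp_diag l"
  by (simp add: adjoint3_def exp_diag_def vec_eq_iff)

lemma det_exp_diag: "l $ 1 + l $ 2 + l $ 3 = 0 \<Longrightarrow> det (exp_diag l) = 1"
  by (simp add: det_3 exp_diag_def exp_add[symmetric] flip: of_real_mult)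

lemma mult_exp_diag_nth: "(M ** exp_diag l) $ i $ j = M $ i $ j * of_real (exp (l $ j))"
  "(exp_diag l ** M) $ i $ j = of_real (exp (l $ i)) * M $ i $ j"
  using exhaust_3[of i] exhaust_3[of j]
  by (auto simp: matrix_matrix_mult_def exp_diag_def sum_3)

lemma cartan_decomp_det: "cartan_decomp g k1 l k2 \<Longrightarrow> det (k1 ** exp_diag l ** k2) = 1"
  by (auto simp: cartan_decomp_def det_mul SU3_iff det_exp_diag)

text \<open>The product with the adjoint cancels the right factor \<open>m\<close>, so left frame
  and exponents can be compared alone.\<close>

lemma cartan_decomp_gram:
  assumes "cartan_decomp g k l m"
  shows "(k ** exp_diag l ** m) ** adjoint3 (k ** exp_diag l ** m) = k ** exp_diag (l + l) ** adjoint3 k"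
proof -
  have "(k ** exp_diag l ** m) ** adjoint3 (k ** exp_diag l ** m)
      = k ** exp_diag l ** (m ** adjoint3 m) ** exp_diag l ** adjoint3 k"
    by (simp only: adjoint3_mult adjoint3_exp_diag matrix_mul_assoc)
  also have "\<dots> = k ** (exp_diag l ** exp_diag l) ** adjoint3 k"
    using assms by (simp only: cartan_decomp_def SU3_unitary(1) matrix_mul_rid matrix_mul_assoc)
  finally show ?thesis by (simp only: exp_diag_add)
qed

text \<open>Two lifts of determinant one differ by a cube root of unity, which drops out of
  \<open>A ** adjoint3 A\<close>. Hence \<open>adjoint3 k' ** k\<close> intertwines the two positive
  diagonal matrices, and a nonzero entry can only join equal eigenvalues.\<close>

lemma cartan_decomp_intertwine:
  assumes "cartan_decomp g k l m" "cartan_decomp g k' l' m'" "(adjoint3 k' ** k) $ i $ j \<noteq> 0"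
  shows "l $ j = l' $ i"
proof -
  let ?A = "k ** exp_diag l ** m" and ?B = "k' ** exp_diag l' ** m'"
  have det: "det ?A = 1" "det ?B = 1"
    using assms by (simp_all add: cartan_decomp_det)
  have "sp3_of ?A = sp3_of ?B"
    using assms by (simp add: cartan_decomp_def)
  then obtain c where c: "?B = mat c ** ?A"
    using det by (subst (asm) sp3_of_eq_iff) (auto intro!: det_nonzero_imp)
  have "c ^ 3 = 1"
    using det c by (metis det_mat_mult mult.right_neutral)
  then have "cmod c ^ 3 = 1" by (metis norm_one norm_power)
  then have "cmod c = 1"
    using power_eq_imp_eq_base[of "cmod c" 3 1] by simp
  then have "c * cnj c = 1" by (simp add: complex_norm_square[symmetric])
  moreover have "?B ** adjoint3 ?B = mat (c * cnj c) ** (?A ** adjoint3 ?A)"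
  proof -
    have "adjoint3 (mat c ** M) = mat (cnj c) ** adjoint3 M" for M
      by (simp add: vec_eq_iff adjoint3_def)
    then have "?B ** adjoint3 ?B = mat c ** (mat (cnj c) ** (?A ** adjoint3 ?A))"
      unfolding c matrix_mul_assoc[of "mat c" ?A, symmetric] by (simp only: mat_mult_commute[of ?A])
    then show ?thesis by (simp add: vec_eq_iff mult_ac)
  qed
  ultimately have "k ** exp_diag (l + l) ** adjoint3 k = k' ** exp_diag (l' + l') ** adjoint3 k'"
    using assms by (simp add: cartan_decomp_gram)
  then have "adjoint3 k' ** (k ** exp_diag (l + l) ** adjoint3 k) ** k
      = adjoint3 k' ** (k' ** exp_diag (l' + l') ** adjoint3 k') ** k"
    by simp
  then have "(adjoint3 k' ** k) ** exp_diag (l + l) ** (adjoint3 k ** k)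
      = (adjoint3 k' ** k') ** exp_diag (l' + l') ** (adjoint3 k' ** k)"
    by (simp only: matrix_mul_assoc)
  then have "(adjoint3 k' ** k) ** exp_diag (l + l) = exp_diag (l' + l') ** (adjoint3 k' ** k)"
    using assms by (simp add: cartan_decomp_def SU3_unitary)
  then have "(adjoint3 k' ** k) $ i $ j * of_real (exp ((l + l) $ j))
      = of_real (exp ((l' + l') $ i)) * (adjoint3 k' ** k) $ i $ j"
    by (metis mult_exp_diag_nth)
  then have "complex_of_real (exp ((l + l) $ j)) = of_real (exp ((l' + l') $ i))"
    using assms(3) by simp
  then show ?thesis by (simp only: of_real_eq_iff exp_inj_iff) simp
qed

text \<open>An invertible matrix has a nonzero term in its Leibniz expansion. Along that permutation
  the exponents agree by intertwining, and since both vectors are sorted the permutation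
  disappears.\<close>

lemma cartan_decomp_unique:
  assumes "cartan_decomp g k l m" "cartan_decomp g k' l' m'"
  shows "l = l'"
proof -
  define M where "M = adjoint3 k' ** k"
  have eq: "l $ j = l' $ i" if "M $ i $ j \<noteq> 0" for i j
    using cartan_decomp_intertwine[OF assms] that unfolding M_def .
  have "k \<in> SU3" "adjoint3 k' \<in> SU3"
    using assms by (auto simp: cartan_decomp_def adjoint3_in_SU3)
  then have "det M \<noteq> 0" by (simp add: M_def det_mul SU3_iff)
  have order: "l $ 1 \<ge> l $ 2" "l $ 2 \<ge> l $ 3" "l' $ 1 \<ge> l' $ 2" "l' $ 2 \<ge> l' $ 3"
    using assms by (auto simp: cartan_decomp_def)
  have "M$1$1 * M$2$2 * M$3$3 \<noteq> 0 \<or> M$1$2 * M$2$3 * M$3$1 \<noteq> 0 \<or> M$1$3 * M$2$1 * M$3$2 \<noteq> 0 \<or>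
      M$1$1 * M$2$3 * M$3$2 \<noteq> 0 \<or> M$1$2 * M$2$1 * M$3$3 \<noteq> 0 \<or> M$1$3 * M$2$2 * M$3$1 \<noteq> 0"
  proof (rule ccontr)
    assume "\<not> ?thesis"
    then have "M$1$1 * M$2$2 * M$3$3 = 0" "M$1$2 * M$2$3 * M$3$1 = 0" "M$1$3 * M$2$1 * M$3$2 = 0"
      "M$1$1 * M$2$3 * M$3$2 = 0" "M$1$2 * M$2$1 * M$3$3 = 0" "M$1$3 * M$2$2 * M$3$1 = 0"
      by blast+
    then have "det M = 0" unfolding det_3 by (simp only:) simp
    with \<open>det M \<noteq> 0\<close> show False ..
  qed
  then consider "M$1$1 \<noteq> 0" "M$2$2 \<noteq> 0" "M$3$3 \<noteq> 0" | "M$1$2 \<noteq> 0" "M$2$3 \<noteq> 0" "M$3$1 \<noteq> 0"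
    | "M$1$3 \<noteq> 0" "M$2$1 \<noteq> 0" "M$3$2 \<noteq> 0" | "M$1$1 \<noteq> 0" "M$2$3 \<noteq> 0" "M$3$2 \<noteq> 0"
    | "M$1$2 \<noteq> 0" "M$2$1 \<noteq> 0" "M$3$3 \<noteq> 0" | "M$1$3 \<noteq> 0" "M$2$2 \<noteq> 0" "M$3$1 \<noteq> 0"
    unfolding mult_eq_0_iff de_Morgan_disj by blast
  then have "l $ 1 = l' $ 1 \<and> l $ 2 = l' $ 2 \<and> l $ 3 = l' $ 3"
  proof cases
    case 1 then show ?thesis using eq by simp
  next
    case 2 show ?thesis using eq[OF 2(1)] eq[OF 2(2)] eq[OF 2(3)] order by linarith
  next
    case 3 show ?thesis using eq[OF 3(1)] eq[OF 3(2)] eq[OF 3(3)] order by linarith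
  next
    case 4 show ?thesis using eq[OF 4(1)] eq[OF 4(2)] eq[OF 4(3)] order by linarith
  next
    case 5 show ?thesis using eq[OF 5(1)] eq[OF 5(2)] eq[OF 5(3)] order by linarith
  next
    case 6 show ?thesis using eq[OF 6(1)] eq[OF 6(2)] eq[OF 6(3)] order by linarith
  qed
  then show ?thesis by (simp add: vec_eq_iff forall_3)
qed

lemma cartan_proj_eq: "cartan_decomp g k l m \<Longrightarrow> cartan_proj g = l"
  unfolding cartan_proj_def by (rule the_equality) (auto dest: cartan_decomp_unique)

lemma mult_axis_column: "A *v axis j 1 = column j A" for A :: "complex^3^3"
proof -
  have "(\<Sum>k\<in>UNIV. A $ i $ k * (axis j 1 :: complex^3) $ k) = A $ i $ j" for i
    by (simp add: axis_def if_distrib[of "\<lambda>x. _ * x"] cong: if_cong)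
  then show ?thesis
    by (simp add: matrix_vector_mult_def column_def vec_eq_iff)
qed

lemma column_SU3_nonzero: "k \<in> SU3 \<Longrightarrow> column j k \<noteq> 0"
  using det_nonzero_mult_vector[of k "axis j 1"]
  by (simp add: SU3_iff mult_axis_column axis_eq_0_iff)

lemma cnj_mat_in_SU3: "k \<in> SU3 \<Longrightarrow> cnj_mat k \<in> SU3"
proof -
  assume k: "k \<in> SU3"
  have "cnj_mat k ** adjoint3 (cnj_mat k) = cnj_mat (k ** adjoint3 k)"
    by (simp add: cnj_mat_def adjoint3_def matrix_matrix_mult_def vec_eq_iff)
  also have "\<dots> = mat 1" using k by (simp add: SU3_iff cnj_mat_def mat_def vec_eq_iff)
  finally have "cnj_mat k ** adjoint3 (cnj_mat k) = mat 1" .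
  moreover have "det (cnj_mat k) = cnj (det k)"
    by (simp add: det_3 cnj_mat_def)
  ultimately show ?thesis using k by (simp add: SU3_iff)
qed

text \<open>The inverse transpose of a unitary matrix is its entrywise conjugate; this is why line
  coordinates are read off \<open>cnj_mat k\<close>.\<close>

lemma flag_act_SU3_standard:
  assumes "k \<in> SU3"
  shows "flag_act (sp3_of k) standard_flag = (cp2_of (column 1 k), cp2_of (column 3 (cnj_mat k)))"
  using assms cnj_mat_in_SU3[OF assms]
  by (simp add: flag_act_def standard_flag_def contragredient_sp3_of SU3_unitary transpose_adjoint3
      psl_act_sp3_of axis_eq_0_iff mult_axis_column)

text \<open>Strict gaps make the three eigenvalues distinct, so the intertwiner
  \<open>adjoint3 k' ** k\<close> is diagonal.\<close>

lemma cartan_decomp_column_eq: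
  assumes "cartan_decomp g k l m" "cartan_decomp g k' l m'" "l $ 1 > l $ 2" "l $ 2 > l $ 3"
  obtains c where "c \<noteq> 0" "column j k = c *s column j k'"
proof -
  let ?M = "adjoint3 k' ** k"
  have M0: "?M $ i $ j = 0" if "i \<noteq> j" for i
  proof (rule ccontr)
    assume "?M $ i $ j \<noteq> 0"
    then have "l $ j = l $ i" by (rule cartan_decomp_intertwine[OF assms(1,2)])
    then show False using that assms(3,4) exhaust_3[of i] exhaust_3[of j] by auto
  qed
  have "k' ** ?M = k"
    using assms by (simp add: cartan_decomp_def SU3_unitary matrix_mul_assoc)
  then have "column j k = column j (k' ** ?M)" by simp
  also have "\<dots> = ?M $ j $ j *s column j k'"
  proof -
    have "(\<Sum>a\<in>UNIV. k' $ i $ a * ?M $ a $ j) = (\<Sum>a\<in>UNIV. if a = j then k' $ i $ j * ?M $ j $ j else 0)" for i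
      by (rule sum.cong) (auto simp: M0)
    then have "(k' ** ?M) $ i $ j = k' $ i $ j * ?M $ j $ j" for i
      unfolding matrix_matrix_mult_def[of k'] by simp
    then show ?thesis by (simp add: column_def vec_eq_iff)
  qed
  finally have eq: "column j k = ?M $ j $ j *s column j k'" .
  moreover have "column j k \<noteq> 0"
    using assms by (auto simp: cartan_decomp_def column_SU3_nonzero)
  ultimately have "?M $ j $ j \<noteq> 0" by auto
  with eq show ?thesis using that by blast
qed

lemma column_cnj_mat: "column j (cnj_mat k) = (\<chi> i. cnj (column j k $ i))"
  by (simp add: column_def cnj_mat_def)

text \<open>The definite description is met because the first and third columns are determined up to
  scalars, which the projective plane does not see.\<close>

lemma left_singular_flag_eq:
  assumes g: "cartan_decomp g k l m" "l $ 1 > l $ 2" "l $ 2 > l $ 3"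
  shows "left_singular_flag g = (cp2_of (column 1 k), cp2_of (column 3 (cnj_mat k)))"
  unfolding left_singular_flag_def
proof (rule the_equality)
  have k: "k \<in> SU3" using g by (simp add: cartan_decomp_def)
  show "\<exists>k1 l k2. cartan_decomp g k1 l k2 \<and>
      (cp2_of (column 1 k), cp2_of (column 3 (cnj_mat k))) = flag_act (sp3_of k1) standard_flag"
    using g flag_act_SU3_standard[OF k] by metis
  fix F assume "\<exists>k1 l k2. cartan_decomp g k1 l k2 \<and> F = flag_act (sp3_of k1) standard_flag"
  then obtain k' l' m' where F: "cartan_decomp g k' l' m'" "F = flag_act (sp3_of k') standard_flag"
    by blast
  with g(1) have "l' = l" by (metis cartan_decomp_unique)
  with F have g': "cartan_decomp g k' l m'" by simp
  then have k': "k' \<in> SU3" by (simp add: cartan_decomp_def)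
  obtain c where c: "c \<noteq> 0" "column 1 k = c *s column 1 k'"
    using cartan_decomp_column_eq[OF g(1) g' g(2,3)] .
  obtain d where d: "d \<noteq> 0" "column 3 k = d *s column 3 k'"
    using cartan_decomp_column_eq[OF g(1) g' g(2,3)] .
  have "cp2_of (column 1 k') = cp2_of (column 1 k)"
    using c k k' by (subst cp2_of_eq_iff) (auto simp: column_SU3_nonzero)
  moreover have "column 3 (cnj_mat k) = cnj d *s column 3 (cnj_mat k')"
    by (simp add: column_cnj_mat d vec_eq_iff)
  then have "cp2_of (column 3 (cnj_mat k')) = cp2_of (column 3 (cnj_mat k))"
    using d k k' by (subst cp2_of_eq_iff) (auto simp: column_SU3_nonzero cnj_mat_in_SU3)
  ultimately show "F = (cp2_of (column 1 k), cp2_of (column 3 (cnj_mat k)))"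
    by (simp add: F flag_act_SU3_standard[OF k'])
qed

section \<open>Convergence in the projective plane\<close>

definition dpair :: "complex^3 \<Rightarrow> complex^3 \<Rightarrow> complex" where
  "dpair f v = (\<Sum>i\<in>UNIV. f $ i * v $ i)"

definition outer :: "complex^3 \<Rightarrow> complex^3 \<Rightarrow> complex^3^3" where
  "outer u f = (\<chi> i j. u $ i * f $ j)"

definition cnj_vec :: "complex^3 \<Rightarrow> complex^3" where
  "cnj_vec v = (\<chi> i. cnj (v $ i))"

text \<open>Collapse onto \<open>p\<close> off the line \<open>m\<close>, encoded by rescaled lifts
  tending to a rank-one matrix: \<open>u\<close> spans its image and \<open>f\<close> is the
  functional whose kernel is \<open>m\<close>. Lifts of determinant one could not converge to such a
  matrix, so only a nonzero determinant is asked.\<close>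

definition attracts :: "(nat \<Rightarrow> sp3) \<Rightarrow> cp2 \<Rightarrow> dual_cp2 \<Rightarrow> bool" where
  "attracts g p m \<longleftrightarrow> (\<exists>B u f. u \<noteq> 0 \<and> f \<noteq> 0 \<and> p = cp2_of u \<and> m = cp2_of f \<and> B \<longlonglongrightarrow> outer u f \<and>
     (\<forall>n. det (B n) \<noteq> 0 \<and> g n = sp3_of (B n)))"

lemma outer_mult_vector: "outer u f *v v = dpair f v *s u"
  by (simp add: outer_def dpair_def matrix_vector_mult_def vec_eq_iff sum_distrib_left mult_ac)

lemma incident_iff_dpair: "v \<noteq> 0 \<Longrightarrow> f \<noteq> 0 \<Longrightarrow> incident (cp2_of v) (cp2_of f) \<longleftrightarrow> dpair f v = 0"
  by (simp add: incident_cp2_of dpair_def)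

lemma incident_commute: "incident x l \<longleftrightarrow> incident l x"
  by (simp add: incident_def mult.commute)

lemma tendsto_dpair: "(f \<longlongrightarrow> a) F \<Longrightarrow> (v \<longlongrightarrow> b) F \<Longrightarrow> ((\<lambda>n. dpair (f n) (v n)) \<longlongrightarrow> dpair a b) F"
  unfolding dpair_def by (intro tendsto_intros)

lemma tendsto_matrix_vector_mult:
  fixes A :: "'b \<Rightarrow> complex^3^3"
  shows "(A \<longlongrightarrow> B) F \<Longrightarrow> (v \<longlongrightarrow> w) F \<Longrightarrow> ((\<lambda>n. A n *v v n) \<longlongrightarrow> B *v w) F"
  unfolding matrix_vector_mult_def by (intro tendsto_intros)

lemma tendsto_cp2_of:
  assumes "(v \<longlongrightarrow> w) F" "w \<noteq> 0"
  shows "((\<lambda>n. cp2_of (v n)) \<longlongrightarrow> cp2_of w) F"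
proof -
  have P: "((\<lambda>n. line_projector (v n)) \<longlongrightarrow> line_projector w) F"
    unfolding line_projector_def using assms by (intro tendsto_intros) auto
  have nz: "eventually (\<lambda>n. v n \<noteq> 0) F"
    using assms by (rule tendsto_imp_eventually_ne)
  show ?thesis
  proof (rule tendstoI)
    fix e :: real assume "e > 0"
    with P have "eventually (\<lambda>n. dist (line_projector (v n)) (line_projector w) < e) F"
      by (rule tendstoD)
    with nz show "eventually (\<lambda>n. dist (cp2_of (v n)) (cp2_of w) < e) F"
      by eventually_elim (simp add: dist_cp2_def line_projector_rep assms(2))
  qed
qed

text \<open>\<open>rep_cp2\<close> is an arbitrary choice and need not be continuous. Projecting one
  fixed representative of the limit onto the varying lines yields representatives that do
  converge.\<close>

lemma cp2_lift:
  fixes x :: "nat \<Rightarrow> cp2"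
  assumes "x \<longlonglongrightarrow> z"
  obtains v where "\<And>n. v n \<noteq> 0" "\<And>n. cp2_of (v n) = x n" "v \<longlonglongrightarrow> rep_cp2 z"
proof -
  let ?P = "\<lambda>y. line_projector (rep_cp2 y)"
  let ?w = "\<lambda>n. ?P (x n) *v rep_cp2 z"
  have "(\<lambda>n. ?P (x n)) \<longlonglongrightarrow> ?P z"
    using assms unfolding tendsto_iff dist_cp2_def .
  then have "?w \<longlonglongrightarrow> ?P z *v rep_cp2 z"
    by (intro tendsto_matrix_vector_mult tendsto_const)
  then have w: "?w \<longlonglongrightarrow> rep_cp2 z"
    by (simp add: line_projector_self rep_cp2_nonzero)
  \<comment> \<open>The projection vanishes for finitely many indices at most; there any
    representative will do.\<close>
  define v where "v n = (if ?w n = 0 then rep_cp2 (x n) else ?w n)" for n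
  have "eventually (\<lambda>n. ?w n \<noteq> 0) sequentially"
    using w rep_cp2_nonzero by (rule tendsto_imp_eventually_ne)
  then have "eventually (\<lambda>n. ?w n = v n) sequentially"
    by eventually_elim (simp add: v_def)
  with w have "v \<longlonglongrightarrow> rep_cp2 z"
    by (rule Lim_transform_eventually)
  moreover have "v n \<noteq> 0" "cp2_of (v n) = x n" for n
    using cp2_of_line_projector_apply[OF rep_cp2_nonzero, of "x n" "rep_cp2 z"]
    by (auto simp: v_def rep_cp2_nonzero)
  ultimately show ?thesis using that by blast
qed

text \<open>Moving points \<open>x n\<close> express locally uniform convergence sequentially. Off
  \<open>m\<close> the limit vector is a nonzero multiple of \<open>u\<close>, so passing to the
  projective plane is continuous there.\<close>

lemma attracts_tendsto:
  assumes "attracts g p m" "x \<longlonglongrightarrow> z" "\<not> incident z m"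
  shows "(\<lambda>n. psl_act (g n) (x n)) \<longlonglongrightarrow> p"
proof -
  obtain B u f where B: "u \<noteq> 0" "f \<noteq> 0" "p = cp2_of u" "m = cp2_of f" "B \<longlonglongrightarrow> outer u f"
    "\<And>n. det (B n) \<noteq> 0" "\<And>n. g n = sp3_of (B n)"
    using assms(1) by (auto simp: attracts_def)
  obtain v where v: "\<And>n. v n \<noteq> 0" "\<And>n. cp2_of (v n) = x n" "v \<longlonglongrightarrow> rep_cp2 z"
    using cp2_lift[OF assms(2)] by blast
  have d: "dpair f (rep_cp2 z) \<noteq> 0"
    using assms(3) B incident_iff_dpair[OF rep_cp2_nonzero, of f z] by simp
  have "(\<lambda>n. B n *v v n) \<longlonglongrightarrow> dpair f (rep_cp2 z) *s u"
    unfolding outer_mult_vector[symmetric] using B v by (intro tendsto_matrix_vector_mult)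
  then have "(\<lambda>n. cp2_of (B n *v v n)) \<longlonglongrightarrow> cp2_of (dpair f (rep_cp2 z) *s u)"
    using d B by (intro tendsto_cp2_of) auto
  moreover have "cp2_of (dpair f (rep_cp2 z) *s u) = p"
    using d B by (subst eq_commute) (auto simp: cp2_of_eq_iff)
  moreover have "cp2_of (B n *v v n) = psl_act (g n) (x n)" for n
    using psl_act_sp3_of[OF B(6) v(1), of n n] B v by simp
  ultimately show ?thesis by simp
qed

lemma incident_limit:
  assumes "x \<longlonglongrightarrow> z" "l \<longlonglongrightarrow> m" "\<And>n. incident (x n) (l n)"
  shows "incident z m"
proof -
  obtain v where v: "\<And>n. v n \<noteq> 0" "\<And>n. cp2_of (v n) = x n" "v \<longlonglongrightarrow> rep_cp2 z"
    using cp2_lift[OF assms(1)] by blast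
  obtain f where f: "\<And>n. f n \<noteq> 0" "\<And>n. cp2_of (f n) = l n" "f \<longlonglongrightarrow> rep_cp2 m"
    using cp2_lift[OF assms(2)] by blast
  have "(\<lambda>n. dpair (f n) (v n)) \<longlonglongrightarrow> dpair (rep_cp2 m) (rep_cp2 z)"
    using f v by (intro tendsto_dpair)
  moreover have "dpair (f n) (v n) = 0" for n
    using assms(3)[of n] v f by (metis incident_iff_dpair)
  ultimately have "dpair (rep_cp2 m) (rep_cp2 z) = 0"
    by (simp add: LIMSEQ_const_iff)
  then show ?thesis by (simp add: incident_def dpair_def)
qed

lemma closed_line_of: "closed (line_of l)"
  unfolding closed_sequential_limits line_of_def using incident_limit[OF _ tendsto_const] by blast

lemma dpair_cnj_vec: "f \<noteq> 0 \<Longrightarrow> dpair f (cnj_vec f) \<noteq> 0"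
proof -
  have "dpair f (cnj_vec f) = of_real ((norm f)\<^sup>2)"
    by (simp only: dpair_def cnj_vec_def vec_lambda_beta norm_cvec_sq)
  then show "f \<noteq> 0 \<Longrightarrow> ?thesis" by simp
qed

lemma dpair_add: "dpair f (v + w) = dpair f v + dpair f w"
  and dpair_diff: "dpair f (v - w) = dpair f v - dpair f w"
  and dpair_smult: "dpair f (c *s v) = c * dpair f v"
  by (simp_all add: dpair_def sum_3 algebra_simps)

lemma tendsto_vector_smult:
  fixes v :: "'b \<Rightarrow> complex^3"
  shows "(c \<longlongrightarrow> a) F \<Longrightarrow> (v \<longlongrightarrow> w) F \<Longrightarrow> ((\<lambda>n. c n *s v n) \<longlongrightarrow> a *s w) F"
  unfolding vector_scalar_mult_def by (intro tendsto_intros)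

text \<open>A point of the line is pushed off it in the direction of the conjugate of the line
  coordinates, on which the functional equals its squared norm.\<close>

lemma open_not_subset_line:
  assumes "open U" "x \<in> U"
  obtains y where "y \<in> U" "\<not> incident y l"
proof (cases "incident x l")
  case False
  then show ?thesis using that assms by blast
next
  case True
  let ?v = "rep_cp2 x" and ?f = "rep_cp2 l"
  let ?w = "\<lambda>n. ?v + of_real (inverse (real (Suc n))) *s cnj_vec ?f"
  have d0: "dpair ?f ?v = 0" using True by (simp add: incident_def dpair_def)
  have d: "dpair ?f (?w n) \<noteq> 0" for n
    using d0 dpair_cnj_vec[OF rep_cp2_nonzero] by (simp add: dpair_add dpair_smult del: of_nat_Suc)
  then have w0: "?w n \<noteq> 0" for n
    by (metis dpair_smult mult_zero_left vector_smult_lzero)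
  have "?w \<longlonglongrightarrow> ?v + of_real 0 *s cnj_vec ?f"
    by (intro tendsto_add tendsto_vector_smult tendsto_const tendsto_of_real LIMSEQ_inverse_real_of_nat)
  then have "(\<lambda>n. cp2_of (?w n)) \<longlonglongrightarrow> cp2_of ?v"
    by (intro tendsto_cp2_of) (simp_all add: rep_cp2_nonzero del: of_nat_Suc)
  then have "eventually (\<lambda>n. cp2_of (?w n) \<in> U) sequentially"
    using assms by (simp add: topological_tendstoD del: of_nat_Suc)
  then obtain n where "cp2_of (?w n) \<in> U"
    by (auto simp: eventually_sequentially)
  moreover have "\<not> incident (cp2_of (?w n)) l"
    using d[of n] incident_iff_dpair[OF w0 rep_cp2_nonzero, of n l] by simp
  ultimately show ?thesis using that by blast
qed

text \<open>\<open>z\<close> is projected onto the varying lines along the conjugates of their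
  coordinates. The correction tends to zero because \<open>z\<close> lies on the limit line; the
  projected vector may vanish for early indices, hence "eventually".\<close>

lemma incident_approximation:
  assumes "l \<longlonglongrightarrow> m" "incident z m"
  obtains x where "x \<longlonglongrightarrow> z" "eventually (\<lambda>n. incident (x n) (l n)) sequentially"
proof -
  obtain f where f: "\<And>n. f n \<noteq> 0" "\<And>n. cp2_of (f n) = l n" "f \<longlonglongrightarrow> rep_cp2 m"
    using cp2_lift[OF assms(1)] by blast
  let ?v = "rep_cp2 z" and ?m = "rep_cp2 m"
  let ?w = "\<lambda>n. ?v - (dpair (f n) ?v / dpair (f n) (cnj_vec (f n))) *s cnj_vec (f n)"
  have "dpair ?m ?v = 0" using assms(2) by (simp add: incident_def dpair_def)
  have cf: "(\<lambda>n. cnj_vec (f n)) \<longlonglongrightarrow> cnj_vec ?m"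
    unfolding cnj_vec_def by (intro tendsto_intros f)
  have "?w \<longlonglongrightarrow> ?v - (dpair ?m ?v / dpair ?m (cnj_vec ?m)) *s cnj_vec ?m"
    by (intro tendsto_diff tendsto_vector_smult tendsto_divide tendsto_dpair f cf tendsto_const
        dpair_cnj_vec rep_cp2_nonzero)
  then have w: "?w \<longlonglongrightarrow> ?v" using \<open>dpair ?m ?v = 0\<close> by simp
  have "eventually (\<lambda>n. ?w n \<noteq> 0) sequentially"
    using w rep_cp2_nonzero by (rule tendsto_imp_eventually_ne)
  then have "eventually (\<lambda>n. incident (cp2_of (?w n)) (l n)) sequentially"
  proof eventually_elim
    case (elim n)
    have "dpair (f n) (?w n) = 0"
      using dpair_cnj_vec[OF f(1)] by (simp add: dpair_diff dpair_smult)
    then show ?case using incident_iff_dpair[OF elim f(1)] f(2) by simp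
  qed
  moreover have "(\<lambda>n. cp2_of (?w n)) \<longlonglongrightarrow> z"
    using tendsto_cp2_of[OF w rep_cp2_nonzero] by simp
  ultimately show ?thesis using that by blast
qed

section \<open>The group action on points and on incidences\<close>

interpretation PSL3: group PSL3 by (rule group_PSL3)

lemma PSL3_cases:
  assumes "g \<in> carrier PSL3"
  obtains A where "g = sp3_of A" "det A = 1"
  using assms by (auto simp: carrier_PSL3)

lemma psl_act_matrix: "det A \<noteq> 0 \<Longrightarrow> psl_act (sp3_of A) x = cp2_of (A *v rep_cp2 x)"
  using psl_act_sp3_of[of A "rep_cp2 x"] by (simp add: rep_cp2_nonzero)

lemma psl_act_mult:
  assumes "g \<in> carrier PSL3" "h \<in> carrier PSL3"
  shows "psl_act (g \<otimes>\<^bsub>PSL3\<^esub> h) x = psl_act g (psl_act h x)"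
proof -
  obtain A where A: "g = sp3_of A" "det A = 1" using assms(1) by (rule PSL3_cases)
  obtain B where B: "h = sp3_of B" "det B = 1" using assms(2) by (rule PSL3_cases)
  have "B *v rep_cp2 x \<noteq> 0"
    using B by (intro det_nonzero_mult_vector) (auto simp: rep_cp2_nonzero)
  then have "psl_act g (psl_act h x) = cp2_of (A *v (B *v rep_cp2 x))"
    using A B by (simp only: psl_act_matrix[of B] psl_act_sp3_of one_neq_zero simp_thms)
  then show ?thesis
    using A B by (simp add: PSL3_mult psl_act_matrix det_mul matrix_vector_mul_assoc)
qed

lemma psl_act_one: "psl_act \<one>\<^bsub>PSL3\<^esub> x = x"
  by (simp add: one_PSL3 psl_act_matrix)

lemma psl_act_inv:
  assumes "g \<in> carrier PSL3"
  shows "psl_act (inv\<^bsub>PSL3\<^esub> g) (psl_act g x) = x" "psl_act g (psl_act (inv\<^bsub>PSL3\<^esub> g) x) = x"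
  using assms by (simp_all add: psl_act_mult[symmetric] psl_act_one)

lemma inv_PSL3:
  assumes "det A = 1"
  shows "inv\<^bsub>PSL3\<^esub> (sp3_of A) = sp3_of (matrix_inv A)"
  using assms matrix_inv_det[of A]
  by (intro PSL3.inv_equality) (auto simp: carrier_PSL3 PSL3_mult one_PSL3)

lemma contragredient_carrier:
  assumes "g \<in> carrier PSL3"
  shows "contragredient g \<in> carrier PSL3" "contragredient (contragredient g) = g"
proof -
  obtain A where A: "g = sp3_of A" "det A = 1" using assms by (rule PSL3_cases)
  have i: "A ** matrix_inv A = mat 1" "det (matrix_inv A) = 1"
    using A matrix_inv_det[of A] by simp_all
  have "transpose (matrix_inv A) ** transpose A = mat 1"
    using i(1) by (metis matrix_transpose_mul transpose_mat)
  then have "matrix_inv (transpose (matrix_inv A)) = transpose A"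
    by (rule matrix_inv_eqI)
  then show "contragredient (contragredient g) = g"
    using A i by (simp add: contragredient_sp3_of det_transpose)
  show "contragredient g \<in> carrier PSL3"
    using A i by (auto simp: contragredient_sp3_of carrier_PSL3 det_transpose intro!: exI[of _ "transpose (matrix_inv A)"])
qed

lemma tendsto_psl_act:
  assumes "g \<in> carrier PSL3" "x \<longlonglongrightarrow> z"
  shows "(\<lambda>n. psl_act g (x n)) \<longlonglongrightarrow> psl_act g z"
proof -
  obtain A where A: "g = sp3_of A" "det A = 1" using assms(1) by (rule PSL3_cases)
  obtain v where v: "\<And>n. v n \<noteq> 0" "\<And>n. cp2_of (v n) = x n" "v \<longlonglongrightarrow> rep_cp2 z"
    using cp2_lift[OF assms(2)] by blast
  have "(\<lambda>n. cp2_of (A *v v n)) \<longlonglongrightarrow> cp2_of (A *v rep_cp2 z)"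
    using A v by (intro tendsto_cp2_of tendsto_matrix_vector_mult det_nonzero_mult_vector rep_cp2_nonzero) auto
  moreover have "cp2_of (A *v v n) = psl_act g (x n)" for n
    using psl_act_sp3_of[of A "v n"] A v by simp
  ultimately show ?thesis using A by (simp add: psl_act_matrix)
qed

lemma incident_psl_act:
  assumes "g \<in> carrier PSL3"
  shows "incident (psl_act g x) (psl_act (contragredient g) l) \<longleftrightarrow> incident x l"
proof -
  have "psl_act g x \<in> line_of (psl_act (contragredient g) l) \<longleftrightarrow> psl_act g x \<in> psl_act g ` line_of l"
    using line_of_contragredient[OF assms] by simp
  also have "\<dots> \<longleftrightarrow> x \<in> line_of l"
    using psl_act_inv(1)[OF assms] by (metis image_iff)
  finally show ?thesis by (simp add: line_of_def)
qed

section \<open>Sequences in a divergent group\<close>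

text \<open>The sign gives this antidiagonal permutation matrix determinant one.\<close>

definition flag_reversal :: "complex^3^3" where
  "flag_reversal = (\<chi> i j. if i = 1 \<and> j = 3 \<or> i = 2 \<and> j = 2 \<or> i = 3 \<and> j = 1 then - 1 else 0)"

lemma flag_reversal_SU3: "flag_reversal \<in> SU3"
  by (simp add: SU3_iff det_3 flag_reversal_def adjoint3_def matrix_matrix_mult_def sum_3 vec_eq_iff
      forall_3 mat_def)

lemma mult_SU3: "k \<in> SU3 \<Longrightarrow> m \<in> SU3 \<Longrightarrow> k ** m \<in> SU3"
proof -
  assume km: "k \<in> SU3" "m \<in> SU3"
  have "(k ** m) ** adjoint3 (k ** m) = k ** (m ** adjoint3 m) ** adjoint3 k"
    by (simp only: adjoint3_mult matrix_mul_assoc)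
  then show ?thesis using km by (simp add: SU3_iff det_mul)
qed

lemma flag_reversal_exp_diag:
  "flag_reversal ** exp_diag (vector [l $ 3, l $ 2, l $ 1]) ** flag_reversal = exp_diag l"
  by (simp add: flag_reversal_def matrix_matrix_mult_def sum_3 vec_eq_iff forall_3 exp_diag_def)

lemma inverse_SU3_exp_diag:
  assumes "k \<in> SU3" "m \<in> SU3"
  shows "matrix_inv (k ** exp_diag l ** m) = adjoint3 m ** exp_diag (- l) ** adjoint3 k"
proof (rule matrix_inv_eqI)
  have "k ** exp_diag l ** m ** (adjoint3 m ** exp_diag (- l) ** adjoint3 k)
    = k ** (exp_diag l ** (m ** adjoint3 m) ** exp_diag (- l)) ** adjoint3 k"
    by (simp only: matrix_mul_assoc)
  then show "k ** exp_diag l ** m ** (adjoint3 m ** exp_diag (- l) ** adjoint3 k) = mat 1"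
    using assms by (simp add: SU3_unitary exp_diag_add exp_diag_0)
qed

lemma cartan_decomp_inverse_eq:
  assumes "cartan_decomp g k l m"
  shows "inv\<^bsub>PSL3\<^esub> g = sp3_of (adjoint3 m ** exp_diag (- l) ** adjoint3 k)"
  using assms cartan_decomp_det[OF assms] inv_PSL3 inverse_SU3_exp_diag
  unfolding cartan_decomp_def by metis

lemma cartan_decomp_contragredient_eq:
  assumes "cartan_decomp g k l m"
  shows "contragredient g = sp3_of (cnj_mat k ** exp_diag (- l) ** cnj_mat m)"
proof -
  have "contragredient g = sp3_of (transpose (adjoint3 m ** exp_diag (- l) ** adjoint3 k))"
    using assms cartan_decomp_det[OF assms] contragredient_sp3_of inverse_SU3_exp_diag
    unfolding cartan_decomp_def by (metis zero_neq_one)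
  moreover have "transpose (exp_diag (- l)) = exp_diag (- l)"
    by (simp add: exp_diag_def transpose_def vec_eq_iff)
  ultimately show ?thesis
    by (simp add: matrix_transpose_mul transpose_adjoint3 matrix_mul_assoc)
qed

text \<open>Inversion negates the exponents and so reverses their order; the reversal matrix on both
  sides sorts them again.\<close>

lemma cartan_decomp_inverse:
  assumes "cartan_decomp g k l m"
  shows "cartan_decomp (inv\<^bsub>PSL3\<^esub> g) (adjoint3 m ** flag_reversal)
    (vector [- l $ 3, - l $ 2, - l $ 1]) (flag_reversal ** adjoint3 k)"
proof -
  have "adjoint3 m ** flag_reversal ** exp_diag (vector [- l $ 3, - l $ 2, - l $ 1]) ** (flag_reversal ** adjoint3 k)
      = adjoint3 m ** (flag_reversal ** exp_diag (vector [(- l) $ 3, (- l) $ 2, (- l) $ 1]) ** flag_reversal) ** adjoint3 k"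
    by (simp only: matrix_mul_assoc) simp
  then have "adjoint3 m ** flag_reversal ** exp_diag (vector [- l $ 3, - l $ 2, - l $ 1]) ** (flag_reversal ** adjoint3 k)
      = adjoint3 m ** exp_diag (- l) ** adjoint3 k"
    unfolding flag_reversal_exp_diag .
  then show ?thesis
    using assms cartan_decomp_inverse_eq[OF assms]
    by (auto simp: cartan_decomp_def mult_SU3 adjoint3_in_SU3 flag_reversal_SU3)
qed

text \<open>The flag of the inverse is the one read off the right factor of \<open>g\<close>. Its
  line has coordinates \<open>row 1 m\<close>, the functional that will define the kernel of the
  rank-one limit; this identifies repelling lines with lines of limit flags.\<close>

lemma left_singular_flag_inverse:
  assumes "cartan_decomp g k l m" "l $ 1 > l $ 2" "l $ 2 > l $ 3"
  shows "left_singular_flag (inv\<^bsub>PSL3\<^esub> g) = (cp2_of (column 3 (adjoint3 m)), cp2_of (row 1 m))"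
proof -
  let ?K = "adjoint3 m ** flag_reversal"
  have m: "adjoint3 m \<in> SU3" using assms by (simp add: cartan_decomp_def adjoint3_in_SU3)
  have 1: "column 1 ?K = (- 1) *s column 3 (adjoint3 m)"
    by (simp add: column_def matrix_matrix_mult_def flag_reversal_def sum_3 vec_eq_iff)
  have 2: "column 3 (cnj_mat ?K) = (- 1) *s row 1 m"
    by (simp add: column_def row_def cnj_mat_def adjoint3_def matrix_matrix_mult_def flag_reversal_def sum_3 vec_eq_iff)
  have K: "?K \<in> SU3" using m flag_reversal_SU3 by (rule mult_SU3)
  have "column 3 (cnj_mat ?K) \<noteq> 0" "column 1 ?K \<noteq> 0" "column 3 (adjoint3 m) \<noteq> 0"
    using K m cnj_mat_in_SU3 column_SU3_nonzero by blast+
  moreover from this have "row 1 m \<noteq> 0" using 2 by auto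
  ultimately have "cp2_of (column 3 (cnj_mat ?K)) = cp2_of (row 1 m)"
    "cp2_of (column 1 ?K) = cp2_of (column 3 (adjoint3 m))"
    using 1 2 by (auto simp: cp2_of_eq_iff intro!: exI[of _ "- 1"])
  then show ?thesis
    using assms by (subst left_singular_flag_eq[OF cartan_decomp_inverse[OF assms(1)]]) auto
qed

lemma norm_SU3_le: "k \<in> SU3 \<Longrightarrow> norm k \<le> 3"
proof -
  assume k: "k \<in> SU3"
  have "norm (k $ i) = 1" for i
  proof -
    have "hdot (k $ i) (k $ i) = (k ** adjoint3 k) $ i $ i"
      by (simp add: hdot_def matrix_matrix_mult_def adjoint3_def)
    also have "\<dots> = 1" using k by (simp add: SU3_unitary mat_def)
    finally show ?thesis by (simp add: hdot_self_eq_1_iff)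
  qed
  then have "(\<Sum>i\<in>UNIV. norm (k $ i)) = 3" by (simp add: sum_3)
  then show ?thesis
    using L2_set_le_sum[of UNIV "\<lambda>i. norm (k $ i)"] by (simp add: norm_vec_def)
qed

lemma compact_SU3: "compact SU3"
  unfolding compact_eq_bounded_closed
proof
  show "bounded SU3" using norm_SU3_le by (rule boundedI)
  have "SU3 = (\<Inter>i. \<Inter>j. {k. (\<Sum>a\<in>UNIV. k $ i $ a * cnj (k $ j $ a)) = mat 1 $ i $ j}) \<inter> {k. det k = 1}"
    by (auto simp: SU3_iff vec_eq_iff matrix_matrix_mult_def adjoint3_def)
  moreover have "closed \<dots>"
    unfolding det_3 by (intro closed_Int closed_INT ballI closed_Collect_eq continuous_intros)
  ultimately show "closed SU3" by simp
qed

text \<open>A common shift of the exponents is a scalar factor, so the dominant one can be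
  normalised to zero, giving up determinant one.\<close>

lemma sp3_of_exp_diag_shift:
  assumes "k \<in> SU3" "m \<in> SU3"
  shows "sp3_of (k ** exp_diag (\<chi> i. l $ i - c) ** m) = sp3_of (k ** exp_diag l ** m)"
    "det (k ** exp_diag l ** m) \<noteq> 0"
proof -
  show d: "det (k ** exp_diag l ** m) \<noteq> 0"
    using assms by (simp add: det_mul SU3_unitary) (simp add: det_3 exp_diag_def)
  have "exp_diag (\<chi> i. l $ i - c) = mat (of_real (exp (- c))) ** exp_diag l"
    by (simp add: vec_eq_iff exp_diag_def exp_diff exp_minus field_simps)
  then have "k ** exp_diag (\<chi> i. l $ i - c) ** m = mat (of_real (exp (- c))) ** (k ** exp_diag l ** m)"
    by (simp only: mat_mult_commute matrix_mul_assoc[symmetric])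
  then show "sp3_of (k ** exp_diag (\<chi> i. l $ i - c) ** m) = sp3_of (k ** exp_diag l ** m)"
    using sp3_of_scale[OF _ det_nonzero_imp[OF d]] by simp
qed

lemma SU3_exp_diag_nth:
  fixes k m :: "complex^3^3"
  shows "(k ** exp_diag l ** m) $ i $ j = (\<Sum>a\<in>UNIV. k $ i $ a * of_real (exp (l $ a)) * m $ a $ j)"
  unfolding matrix_matrix_mult_def[of _ m] by (simp add: mult_exp_diag_nth)

text \<open>With exponent \<open>i\<close> normalised to zero the others tend to minus infinity, so
  the diagonal factor tends to the \<open>i\<close>-th diagonal matrix unit. The index is 1 for the
  elements themselves and 3 for inverses and contragredients, whose exponents are negated.\<close>

lemma attracts_SU3:
  assumes K: "\<And>n. k n \<in> SU3" "k' \<in> SU3" "k \<longlonglongrightarrow> k'"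
    and M: "\<And>n. m n \<in> SU3" "m' \<in> SU3" "m \<longlonglongrightarrow> m'"
    and l: "\<And>j. j \<noteq> i \<Longrightarrow> filterlim (\<lambda>n. l n $ i - l n $ j) at_top sequentially"
    and g: "\<And>n. g n = sp3_of (k n ** exp_diag (l n) ** m n)"
  shows "attracts g (cp2_of (column i k')) (cp2_of (row i m'))"
  unfolding attracts_def
proof (intro exI conjI allI)
  let ?B = "\<lambda>n. k n ** exp_diag (\<chi> j. l n $ j - l n $ i) ** m n"
  show "det (?B n) \<noteq> 0" "g n = sp3_of (?B n)" for n
    using K M g by (simp_all add: sp3_of_exp_diag_shift)
  show "column i k' \<noteq> 0" using K by (simp add: column_SU3_nonzero)
  have "transpose m' \<in> SU3"
    using adjoint3_in_SU3[OF cnj_mat_in_SU3[OF M(2)]] by (simp add: adjoint3_def cnj_mat_def transpose_def)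
  then show "row i m' \<noteq> 0" using column_SU3_nonzero[of "transpose m'" i] by (simp add: column_transpose)
  have e: "(\<lambda>n. exp (l n $ j - l n $ i)) \<longlonglongrightarrow> (if j = i then 1 else 0)" for j
  proof (cases "j = i")
    case False
    have "filterlim (\<lambda>n. - (l n $ i - l n $ j)) at_bot sequentially"
      using l[OF False] by (simp only: filterlim_uminus_at_bot minus_minus)
    then have "filterlim (\<lambda>n. l n $ j - l n $ i) at_bot sequentially" by simp
    then show ?thesis using False filterlim_compose[OF exp_at_bot] by auto
  qed simp
  show "?B \<longlonglongrightarrow> outer (column i k') (row i m')"
  proof (intro vec_tendstoI)
    fix a b
    have "(\<lambda>n. ?B n $ a $ b) \<longlonglongrightarrow> (\<Sum>c\<in>UNIV. k' $ a $ c * of_real (if c = i then 1 else 0) * m' $ c $ b)"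
      unfolding SU3_exp_diag_nth vec_lambda_beta by (intro tendsto_intros K M e)
    also have "(\<Sum>c\<in>UNIV. k' $ a $ c * of_real (if c = i then 1 else 0) * m' $ c $ b)
        = (\<Sum>c\<in>UNIV. if c = i then k' $ a $ i * m' $ i $ b else 0)"
      by (rule sum.cong) auto
    also have "\<dots> = outer (column i k') (row i m') $ a $ b"
      by (simp add: outer_def column_def row_def)
    finally show "(\<lambda>n. ?B n $ a $ b) \<longlonglongrightarrow> outer (column i k') (row i m') $ a $ b" .
  qed
qed (rule refl)+

lemma tendsto_column:
  fixes A :: "'b \<Rightarrow> complex^3^3"
  shows "(A \<longlongrightarrow> B) F \<Longrightarrow> ((\<lambda>n. column j (A n)) \<longlongrightarrow> column j B) F"
  unfolding column_def by (intro tendsto_intros)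

lemma tendsto_adjoint3: "(A \<longlongrightarrow> B) F \<Longrightarrow> ((\<lambda>n. adjoint3 (A n)) \<longlongrightarrow> adjoint3 B) F"
  unfolding adjoint3_def by (intro tendsto_intros)

lemma tendsto_cnj_mat: "(A \<longlongrightarrow> B) F \<Longrightarrow> ((\<lambda>n. cnj_mat (A n)) \<longlongrightarrow> cnj_mat B) F"
  unfolding cnj_mat_def by (intro tendsto_intros)

lemma theta_divergent_subsequence:
  fixes g :: "nat \<Rightarrow> sp3"
  assumes G: "subgroup G PSL3" "theta_divergent G" and g: "inj g" "range g \<subseteq> G"
  obtains r p l q m where "strict_mono r" "incident p l" "incident q m"
    "(\<lambda>n. left_singular_flag (g (r n))) \<longlonglongrightarrow> (p, l)"
    "(\<lambda>n. left_singular_flag (inv\<^bsub>PSL3\<^esub> g (r n))) \<longlonglongrightarrow> (q, m)"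
    "attracts (\<lambda>n. g (r n)) p m" "attracts (\<lambda>n. inv\<^bsub>PSL3\<^esub> g (r n)) q l"
    "attracts (\<lambda>n. contragredient (g (r n))) l q"
proof -
  have "\<exists>k l m. cartan_decomp (g n) k l m" for n
  proof -
    have "g n \<in> carrier PSL3" using g G subgroup.subset by blast
    then show ?thesis using cartan_decomp_exists by (auto elim: PSL3_cases)
  qed
  then obtain k l m where c: "\<And>n. cartan_decomp (g n) (k n) (l n) (m n)"
    by metis
  have SU: "k n \<in> SU3" "m n \<in> SU3" for n
    using c[of n] by (simp_all add: cartan_decomp_def)
  have gaps: "gap1 (g n) = l n $ 1 - l n $ 2" "gap2 (g n) = l n $ 2 - l n $ 3" for n
    by (simp_all add: gap1_def gap2_def cartan_proj_eq[OF c])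
  have "compact (SU3 \<times> SU3)" using compact_SU3 by (intro compact_Times)
  then have "seq_compact (SU3 \<times> SU3 :: ((complex^3^3) \<times> (complex^3^3)) set)"
    by (rule compact_imp_seq_compact)
  moreover have "\<forall>n. (k n, m n) \<in> SU3 \<times> SU3" using SU by simp
  ultimately obtain km r where km: "km \<in> SU3 \<times> SU3" and r: "strict_mono r" "((\<lambda>n. (k n, m n)) \<circ> r) \<longlonglongrightarrow> km"
    by (rule seq_compactE)
  obtain k' m' where "km = (k', m')" by fastforce
  with km r(2) have SU': "k' \<in> SU3" "m' \<in> SU3"
    and k: "(\<lambda>n. k (r n)) \<longlonglongrightarrow> k'" and m: "(\<lambda>n. m (r n)) \<longlonglongrightarrow> m'"
    by (auto simp: o_def dest: tendsto_fst tendsto_snd)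
  have "inj (\<lambda>n. g (r n))"
    using g(1) strict_mono_eq[OF r(1)] by (auto simp: inj_on_def)
  then have lim: "filterlim (\<lambda>n. l (r n) $ 1 - l (r n) $ 2) at_top sequentially"
    "filterlim (\<lambda>n. l (r n) $ 2 - l (r n) $ 3) at_top sequentially"
    using G(2) g(2) unfolding theta_divergent_def gaps[symmetric] by blast+
  have "filterlim (\<lambda>n. (l (r n) $ 1 - l (r n) $ 2) + (l (r n) $ 2 - l (r n) $ 3)) at_top sequentially"
    using lim by (rule filterlim_at_top_add_at_top)
  then have lim3: "filterlim (\<lambda>n. l (r n) $ 1 - l (r n) $ 3) at_top sequentially" by simp
  have first: "filterlim (\<lambda>n. l (r n) $ 1 - l (r n) $ j) at_top sequentially" if "j \<noteq> 1" for j
    using that lim lim3 exhaust_3[of j] by auto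
  have last: "filterlim (\<lambda>n. (- l (r n)) $ 3 - (- l (r n)) $ j) at_top sequentially" if "j \<noteq> 3" for j
    using that lim lim3 exhaust_3[of j] by auto
  define p where "p = cp2_of (column 1 k')"
  define L where "L = cp2_of (column 3 (cnj_mat k'))"
  define q where "q = cp2_of (column 3 (adjoint3 m'))"
  define M where "M = cp2_of (row 1 m')"
  \<comment> \<open>The column formulas for singular flags hold only for strict gaps, that is, from
    some index on.\<close>
  have ev: "eventually (\<lambda>n. l (r n) $ 1 > l (r n) $ 2 \<and> l (r n) $ 2 > l (r n) $ 3) sequentially"
    using lim[unfolded filterlim_at_top_dense] by (auto dest!: spec[of _ 0] elim: eventually_elim2)
  \<comment> \<open>These coincidences link the three collapses: the line repelling the inverses is
    the attracting line of the sequence, and the pencil repelling the contragredients is centred at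
    \<open>q\<close>.\<close>
  have rows: "row 3 (adjoint3 k') = column 3 (cnj_mat k')" "row 3 (cnj_mat m') = column 3 (adjoint3 m')"
    by (simp_all add: row_def column_def adjoint3_def cnj_mat_def transpose_def)
  have tm: "transpose m' \<in> SU3"
    using adjoint3_in_SU3[OF cnj_mat_in_SU3[OF SU'(2)]] by (simp add: adjoint3_def cnj_mat_def transpose_def)
  have nz: "column 1 k' \<noteq> 0" "column 3 (cnj_mat k') \<noteq> 0" "column 3 (adjoint3 m') \<noteq> 0" "row 1 m' \<noteq> 0"
    using SU' column_SU3_nonzero[OF tm, of 1]
    by (simp_all add: column_SU3_nonzero cnj_mat_in_SU3 adjoint3_in_SU3 column_transpose)
  have "(\<lambda>n. (cp2_of (column 1 (k (r n))), cp2_of (column 3 (cnj_mat (k (r n)))))) \<longlonglongrightarrow> (p, L)"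
    unfolding p_def L_def by (intro tendsto_Pair tendsto_cp2_of tendsto_column tendsto_cnj_mat k nz)
  moreover have "eventually (\<lambda>n. (cp2_of (column 1 (k (r n))), cp2_of (column 3 (cnj_mat (k (r n)))))
      = left_singular_flag (g (r n))) sequentially"
    using ev by eventually_elim (simp add: left_singular_flag_eq[OF c])
  ultimately have flag: "(\<lambda>n. left_singular_flag (g (r n))) \<longlonglongrightarrow> (p, L)"
    by (rule Lim_transform_eventually)
  have "(\<lambda>n. row 1 (m (r n))) \<longlonglongrightarrow> row 1 m'"
    unfolding row_def by (intro tendsto_intros m)
  then have "(\<lambda>n. (cp2_of (column 3 (adjoint3 (m (r n)))), cp2_of (row 1 (m (r n))))) \<longlonglongrightarrow> (q, M)"
    unfolding q_def M_def by (intro tendsto_Pair tendsto_cp2_of tendsto_column tendsto_adjoint3 m nz)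
  moreover have "eventually (\<lambda>n. (cp2_of (column 3 (adjoint3 (m (r n)))), cp2_of (row 1 (m (r n))))
      = left_singular_flag (inv\<^bsub>PSL3\<^esub> g (r n))) sequentially"
    using ev by eventually_elim (simp add: left_singular_flag_inverse[OF c])
  ultimately have iflag: "(\<lambda>n. left_singular_flag (inv\<^bsub>PSL3\<^esub> g (r n))) \<longlonglongrightarrow> (q, M)"
    by (rule Lim_transform_eventually)
  \<comment> \<open>Incidence of the limit flag is orthogonality of two different columns of the
    unitary limit.\<close>
  have "dpair (column 3 (cnj_mat k')) (column 1 k') = (adjoint3 k' ** k') $ 3 $ 1"
    by (simp add: dpair_def column_def cnj_mat_def adjoint3_def matrix_matrix_mult_def)
  then have pL: "incident p L"
    using nz SU' by (simp add: p_def L_def incident_iff_dpair SU3_unitary mat_def)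
  have "dpair (row 1 m') (column 3 (adjoint3 m')) = (m' ** adjoint3 m') $ 1 $ 3"
    by (simp add: dpair_def column_def row_def adjoint3_def matrix_matrix_mult_def)
  then have qM: "incident q M"
    using nz SU' by (simp add: q_def M_def incident_iff_dpair SU3_unitary mat_def)
  have att: "attracts (\<lambda>n. g (r n)) p M"
    unfolding p_def M_def using SU SU' k m first c
    by (intro attracts_SU3[where k = "\<lambda>n. k (r n)" and m = "\<lambda>n. m (r n)" and l = "\<lambda>n. l (r n)"])
      (auto simp: cartan_decomp_def)
  have iatt: "attracts (\<lambda>n. inv\<^bsub>PSL3\<^esub> g (r n)) q L"
    unfolding q_def L_def rows(1)[symmetric]
    by (rule attracts_SU3[where k = "\<lambda>n. adjoint3 (m (r n))" and m = "\<lambda>n. adjoint3 (k (r n))" and l = "\<lambda>n. - l (r n)"])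
      (intro adjoint3_in_SU3 SU SU' tendsto_adjoint3 k m last cartan_decomp_inverse_eq c | assumption)+
  have catt: "attracts (\<lambda>n. contragredient (g (r n))) L q"
    unfolding q_def L_def rows(2)[symmetric]
    by (rule attracts_SU3[where k = "\<lambda>n. cnj_mat (k (r n))" and m = "\<lambda>n. cnj_mat (m (r n))" and l = "\<lambda>n. - l (r n)"])
      (intro cnj_mat_in_SU3 SU SU' tendsto_cnj_mat k m last cartan_decomp_contragredient_eq c | assumption)+
  show ?thesis
    by (rule that[OF r(1) pL qM flag iflag att iatt catt])
qed

section \<open>Limits in the space of pseudo-projective maps\<close>

text \<open>The recursion carries the finite set of values already used, and an infinite
  \<open>S n\<close> always offers a new one. It converts infinitely many elements at every scale
  into one sequence of distinct elements.\<close>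

lemma injective_selection:
  fixes S :: "nat \<Rightarrow> 'a set"
  assumes "\<And>n. infinite (S n)"
  obtains h where "inj h" "\<And>n. h n \<in> S n"
proof -
  have "\<exists>f. \<forall>n. (finite (fst (f n)) \<and> snd (f n) \<in> S n - fst (f n)) \<and> fst (f (Suc n)) = insert (snd (f n)) (fst (f n))"
  proof (rule dependent_nat_choice)
    have "S 0 \<noteq> {}" using assms[of 0] by auto
    then show "\<exists>x. finite (fst x) \<and> snd x \<in> S 0 - fst x"
      by (intro exI[of _ "({}, SOME y. y \<in> S 0)"]) (auto intro: someI)
  next
    fix x n assume "finite (fst x) \<and> snd x \<in> S n - fst x"
    then have "infinite (S (Suc n) - insert (snd x) (fst x))"
      using assms by (intro Diff_infinite_finite) auto
    then obtain y where "y \<in> S (Suc n) - insert (snd x) (fst x)"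
      by (metis all_not_in_conv finite.emptyI)
    then show "\<exists>y. (finite (fst y) \<and> snd y \<in> S (Suc n) - fst y) \<and> fst y = insert (snd x) (fst x)"
      using \<open>finite (fst x) \<and> _\<close> by (intro exI[of _ "(insert (snd x) (fst x), y)"]) auto
  qed
  then obtain f :: "nat \<Rightarrow> 'a set \<times> 'a" where
    f: "\<And>n. snd (f n) \<in> S n" "\<And>n. snd (f n) \<notin> fst (f n)" "\<And>n. fst (f (Suc n)) = insert (snd (f n)) (fst (f n))"
    by blast
  have mem: "snd (f i) \<in> fst (f j)" if "i < j" for i j
    using that by (induction j) (auto simp: f(3) less_Suc_eq)
  have "inj (\<lambda>n. snd (f n))"
    using mem f(2) by (intro linorder_injI) metis
  with f(1) show ?thesis using that by blast
qed

lemma isCont_psl_act: "g \<in> carrier PSL3 \<Longrightarrow> isCont (psl_act g) z"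
  unfolding continuous_at_sequentially o_def using tendsto_psl_act by blast

text \<open>The quotient topology on pseudo-projective maps carries no separation instance; the scale-invariant
  sets \<open>Q\<close> below separate two non-proportional matrices.\<close>

lemma sp3_limit_unique:
  assumes "B \<longlonglongrightarrow> D" "D \<noteq> 0" "(\<lambda>n. sp3_of (B n)) \<longlonglongrightarrow> S"
  shows "S = sp3_of D"
proof -
  let ?C = "rep_sp3 S"
  have cross: "?C $ i $ j * D $ a $ b = ?C $ a $ b * D $ i $ j" for i j a b
  proof (rule ccontr)
    assume neq: "?C $ i $ j * D $ a $ b \<noteq> ?C $ a $ b * D $ i $ j"
    let ?h = "\<lambda>A :: complex^3^3. cmod (A $ i $ j * D $ a $ b - A $ a $ b * D $ i $ j)"
    \<comment> \<open>Half of the normalised value of \<open>?h\<close> at \<open>?C\<close>: the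
      class of \<open>?C\<close> lies strictly inside the open set, while \<open>?h D = 0\<close>
      keeps the limit of \<open>B\<close> away from it.\<close>
    define e where "e = ?h ?C / (2 * norm ?C)"
    have e: "e > 0" "?h ?C > e * norm ?C"
      using neq rep_sp3_nonzero[of S] by (auto simp: e_def)
    define Q where "Q = {A. A \<noteq> 0 \<and> ?h A > e * norm A}"
    have "open ({A. A \<noteq> 0} \<inter> {A. e * norm A < ?h A})"
      by (intro open_Int open_Collect_less open_Collect_neq continuous_intros)
    then have "open Q" by (simp add: Q_def Collect_conj_eq)
    moreover have sat: "B \<in> Q" if "A \<in> Q" "B = mat c ** A" "c \<noteq> 0" for A B c
    proof -
      have "norm (B $ x) = cmod c * norm (A $ x)" for x
      proof -
        have "B $ x = c *s A $ x" using that by (simp add: vec_eq_iff)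
        then show ?thesis by (simp add: norm_cvec_smult)
      qed
      then have "norm B = cmod c * norm A"
        by (simp add: norm_vec_def[where 'b = 3 and 'a = "complex^3"] L2_set_right_distrib)
      moreover have "B $ i $ j * D $ a $ b - B $ a $ b * D $ i $ j = c * (A $ i $ j * D $ a $ b - A $ a $ b * D $ i $ j)"
        using that by (simp add: algebra_simps)
      ultimately have "?h B = cmod c * ?h A" "norm B = cmod c * norm A"
        by (simp_all only: norm_mult)
      moreover have "cmod c * (e * norm A) < cmod c * ?h A"
        using that by (simp add: Q_def)
      ultimately show ?thesis
        using that by (auto simp: Q_def mult.left_commute)
    qed
    have "{A. A \<noteq> 0 \<and> sp3_of A \<in> sp3_of ` Q} = Q"
    proof (intro equalityI subsetI)
      fix A assume "A \<in> {A. A \<noteq> 0 \<and> sp3_of A \<in> sp3_of ` Q}"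
      then obtain A' where "A \<noteq> 0" "A' \<in> Q" "sp3_of A' = sp3_of A" by auto
      moreover from this have "A' \<noteq> 0" by (simp add: Q_def)
      ultimately obtain c where "c \<noteq> 0" "A = mat c ** A'" using sp3_of_eq_iff by blast
      with \<open>A' \<in> Q\<close> show "A \<in> Q" using sat by blast
    qed (auto simp: Q_def)
    with \<open>open Q\<close> have "open (sp3_of ` Q)" by (simp add: open_sp3_def)
    moreover have "S \<in> sp3_of ` Q"
    proof (rule image_eqI[of _ _ ?C])
      show "?C \<in> Q" using e rep_sp3_nonzero by (simp add: Q_def)
    qed simp
    ultimately have "eventually (\<lambda>n. sp3_of (B n) \<in> sp3_of ` Q) sequentially"
      using assms(3) by (simp add: topological_tendstoD)
    moreover have "eventually (\<lambda>n. B n \<noteq> 0) sequentially"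
      using assms(1,2) by (rule tendsto_imp_eventually_ne)
    ultimately have "eventually (\<lambda>n. e * norm (B n) \<le> ?h (B n)) sequentially"
    proof eventually_elim
      case (elim n)
      then have "B n \<in> {A. A \<noteq> 0 \<and> sp3_of A \<in> sp3_of ` Q}" by simp
      with \<open>_ = Q\<close> have "B n \<in> Q" by simp
      then show ?case by (simp add: Q_def)
    qed
    moreover have "(\<lambda>n. e * norm (B n)) \<longlonglongrightarrow> e * norm D" "(\<lambda>n. ?h (B n)) \<longlonglongrightarrow> ?h D"
      by (intro tendsto_intros assms(1))+
    ultimately have "e * norm D \<le> ?h D"
      by (intro tendsto_le[OF sequentially_bot])
    then have "e * norm D \<le> 0" by (simp add: mult.commute)
    then show False using e(1) assms(2) by (simp add: mult_le_0_iff)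
  qed
  obtain a b where ab: "D $ a $ b \<noteq> 0" using assms(2) by (auto simp: vec_eq_iff)
  define c where "c = ?C $ a $ b / D $ a $ b"
  have C: "?C = mat c ** D"
    using cross[of _ _ a b] ab by (simp add: vec_eq_iff c_def field_simps)
  then have "c \<noteq> 0" using rep_sp3_nonzero[of S] by (auto simp: vec_eq_iff)
  then show ?thesis
    using C assms(2) sp3_of_scale[of c D] by (metis sp3_of_rep)
qed

lemma sp_rank_outer:
  assumes "u \<noteq> 0" "f \<noteq> 0"
  shows "outer u f \<noteq> 0" "sp_rank (sp3_of (outer u f)) = 1"
proof -
  obtain i j where "u $ i \<noteq> 0" "f $ j \<noteq> 0" using assms by (auto simp: vec_eq_iff)
  then have "outer u f $ i $ j \<noteq> 0" by (simp add: outer_def)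
  then show nz: "outer u f \<noteq> 0" by (metis zero_index)
  then obtain c where c: "c \<noteq> 0" "rep_sp3 (sp3_of (outer u f)) = mat c ** outer u f"
    by (rule rep_sp3_of)
  let ?R = "rows (mat c ** outer u f)"
  have r: "row a (mat c ** outer u f) = (c * u $ a) *s f" for a
    by (simp add: row_def outer_def vec_eq_iff)
  have "?R \<subseteq> vec.span {f}"
    by (auto simp: rows_def r vec.span_singleton)
  moreover have "f \<in> vec.span ?R"
  proof -
    have "f = inverse (c * u $ i) *s ((c * u $ i) *s f)"
      using c(1) \<open>u $ i \<noteq> 0\<close>
      by (simp only: vector_smult_assoc left_inverse mult_eq_0_iff simp_thms vector_smult_lid)
    moreover have "(c * u $ i) *s f \<in> ?R" using r by (auto simp: rows_def)
    ultimately show ?thesis by (metis vec.span_base vec.span_scale)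
  qed
  ultimately have "vec.span ?R = vec.span {f}"
    by (intro equalityI vec.span_minimal) (auto simp: vec.subspace_span)
  then have "vec.dim ?R = vec.dim {f}" by (metis vec.dim_span)
  then show "sp_rank (sp3_of (outer u f)) = 1"
    using assms(2) by (simp add: sp_rank_def c row_rank_def_gen vec.dim_singleton)
qed

lemma sp_rank_attracts_limit:
  assumes "attracts g p m" "g \<longlonglongrightarrow> S"
  shows "sp_rank S = 1"
proof -
  obtain B u f where B: "u \<noteq> 0" "f \<noteq> 0" "B \<longlonglongrightarrow> outer u f" "\<And>n. g n = sp3_of (B n)"
    using assms(1) by (auto simp: attracts_def)
  have "g = (\<lambda>n. sp3_of (B n))" using B(4) by (rule ext)
  with assms(2) have "(\<lambda>n. sp3_of (B n)) \<longlonglongrightarrow> S" by simp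
  with B have "S = sp3_of (outer u f)" by (intro sp3_limit_unique) (auto simp: sp_rank_outer)
  then show ?thesis using B by (simp add: sp_rank_outer)
qed

section \<open>Limit sets and the normality domain\<close>

lemma tendsto_of_dist:
  fixes a b :: "nat \<Rightarrow> 'a::metric_space"
  assumes "a \<longlonglongrightarrow> z" "\<And>n. dist (a n) (b n) < inverse (real (Suc n))"
  shows "b \<longlonglongrightarrow> z"
proof (rule tendstoI)
  fix e :: real assume "e > 0"
  then have "e / 2 > 0" by simp
  have "eventually (\<lambda>n. dist (a n) z < e / 2) sequentially"
    using assms(1) \<open>e / 2 > 0\<close> by (rule tendstoD)
  moreover have "eventually (\<lambda>n. inverse (real (Suc n)) < e / 2) sequentially"
    using LIMSEQ_inverse_real_of_nat \<open>e / 2 > 0\<close> by (rule order_tendstoD)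
  ultimately show "eventually (\<lambda>n. dist (b n) z < e) sequentially"
  proof eventually_elim
    case (elim n)
    then show ?case
      using assms(2)[of n] dist_triangle[of "b n" z "a n"] by (simp add: dist_commute)
  qed
qed

lemma inj_subsequence:
  fixes r :: "nat \<Rightarrow> nat"
  shows "inj g \<Longrightarrow> strict_mono r \<Longrightarrow> inj (\<lambda>n. g (r n))"
  using inj_compose[of g r] strict_mono_imp_inj_on[of r UNIV] by (simp add: o_def)

lemma infinite_hits:
  assumes "inj g" "range g \<subseteq> G" "eventually (\<lambda>n. P (g n)) sequentially"
  shows "infinite {x \<in> G. P x}"
proof -
  obtain N where N: "\<And>n. n \<ge> N \<Longrightarrow> P (g n)"
    using assms(3) by (auto simp: eventually_sequentially)
  have "infinite (g ` {N..})"
    using assms(1) finite_imageD[of g "{N..}"] by (auto simp: inj_on_def infinite_Ici)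
  moreover have "g ` {N..} \<subseteq> {x \<in> G. P x}"
    using assms(2) N by auto
  ultimately show ?thesis using finite_subset by blast
qed

lemma mem_Th_inc: "x \<in> Th_inc L \<longleftrightarrow> (\<exists>p l. (p, l) \<in> L \<and> incident x l)"
  by (auto simp: Th_inc_def line_of_def)

section \<open>Limit flags as attractors and repellers of sequences\<close>

locale divergent_group =
  fixes G :: "sp3 set"
  assumes G: "subgroup G PSL3" and div: "theta_divergent G"
begin

lemma in_carrier: "g \<in> G \<Longrightarrow> g \<in> carrier PSL3"
  using subgroup.subset[OF G] by blast

lemma inv_in: "g \<in> G \<Longrightarrow> inv\<^bsub>PSL3\<^esub> g \<in> G"
  using G by (rule subgroup.m_inv_closed)

lemma mult_in: "g \<in> G \<Longrightarrow> h \<in> G \<Longrightarrow> g \<otimes>\<^bsub>PSL3\<^esub> h \<in> G"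
  using G by (rule subgroup.m_closed)

text \<open>The inverses are again distinct elements of the group, so the repelling data
  \<open>(q, m)\<close> form a limit flag as well. All later contradictions off the limit lines rest
  on this.\<close>

lemma subsequence:
  fixes g :: "nat \<Rightarrow> sp3"
  assumes g: "inj g" "range g \<subseteq> G"
  obtains r p l q m where "strict_mono r" "inj (\<lambda>n. g (r n))" "incident p l"
    "(p, l) \<in> flag_limit_set G" "(q, m) \<in> flag_limit_set G"
    "(\<lambda>n. left_singular_flag (g (r n))) \<longlonglongrightarrow> (p, l)"
    "attracts (\<lambda>n. g (r n)) p m" "attracts (\<lambda>n. inv\<^bsub>PSL3\<^esub> g (r n)) q l"
    "attracts (\<lambda>n. contragredient (g (r n))) l q"
proof -
  obtain r p l q m where r: "strict_mono r" and inc: "incident p l" "incident q m"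
    and fl: "(\<lambda>n. left_singular_flag (g (r n))) \<longlonglongrightarrow> (p, l)"
      "(\<lambda>n. left_singular_flag (inv\<^bsub>PSL3\<^esub> g (r n))) \<longlonglongrightarrow> (q, m)"
    and att: "attracts (\<lambda>n. g (r n)) p m" "attracts (\<lambda>n. inv\<^bsub>PSL3\<^esub> g (r n)) q l"
      "attracts (\<lambda>n. contragredient (g (r n))) l q"
    using theta_divergent_subsequence[OF G div g] .
  have inj: "inj (\<lambda>n. g (r n))"
    using g(1) r by (rule inj_subsequence)
  have rg: "g (r n) \<in> G" for n using g(2) by auto
  have "inj (\<lambda>n. inv\<^bsub>PSL3\<^esub> g (r n))"
  proof (rule injI)
    fix a b assume "inv\<^bsub>PSL3\<^esub> g (r a) = inv\<^bsub>PSL3\<^esub> g (r b)"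
    then have "g (r a) = g (r b)" using PSL3.inv_inv[OF in_carrier[OF rg]] by metis
    then show "a = b" using injD[OF inj] by blast
  qed
  moreover have "range (\<lambda>n. inv\<^bsub>PSL3\<^esub> g (r n)) \<subseteq> G" using rg inv_in by auto
  ultimately have "(q, m) \<in> flag_limit_set G"
    using fl(2) inc(2) unfolding flag_limit_set_def flags_def by blast
  moreover have "(p, l) \<in> flag_limit_set G"
    using fl(1) inc(1) inj rg unfolding flag_limit_set_def flags_def by blast
  ultimately show ?thesis
    using that[OF r inj inc(1) _ _ fl(1) att] by blast
qed

text \<open>Compactness only produces some limit flag; since the given singular flags already
  converge to \<open>(p, l)\<close>, uniqueness of limits identifies the two.\<close>

lemma flag_limit_sequence:
  assumes "(p, l) \<in> flag_limit_set G"
  obtains g q m where "inj g" "range g \<subseteq> G" "incident p l" "(q, m) \<in> flag_limit_set G"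
    "attracts g p m" "attracts (\<lambda>n. inv\<^bsub>PSL3\<^esub> g n) q l" "attracts (\<lambda>n. contragredient (g n)) l q"
proof -
  obtain g where g: "inj g" "range g \<subseteq> G" and lim: "(\<lambda>n. left_singular_flag (g n)) \<longlonglongrightarrow> (p, l)"
    using assms by (auto simp: flag_limit_set_def)
  obtain r p' l' q m where r: "strict_mono r" "inj (\<lambda>n. g (r n))" "incident p' l'"
    and fl: "(p', l') \<in> flag_limit_set G" "(q, m) \<in> flag_limit_set G"
      "(\<lambda>n. left_singular_flag (g (r n))) \<longlonglongrightarrow> (p', l')"
    and att: "attracts (\<lambda>n. g (r n)) p' m" "attracts (\<lambda>n. inv\<^bsub>PSL3\<^esub> g (r n)) q l'"
      "attracts (\<lambda>n. contragredient (g (r n))) l' q"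
    using subsequence[OF g] .
  have "(\<lambda>n. left_singular_flag (g (r n))) \<longlonglongrightarrow> (p, l)"
    using LIMSEQ_subseq_LIMSEQ[OF lim r(1)] by (simp add: o_def)
  then have "(p', l') = (p, l)" using fl(3) LIMSEQ_unique by blast
  moreover have "range (\<lambda>n. g (r n)) \<subseteq> G" using g(2) by auto
  ultimately show ?thesis using that r fl att by auto
qed

lemma SP_boundary_rank:
  assumes "S \<in> SP_boundary G"
  shows "sp_rank S = 1"
proof -
  obtain g :: "nat \<Rightarrow> sp3" where g: "inj g" "range g \<subseteq> G" "g \<longlonglongrightarrow> S"
    using assms by (auto simp: SP_boundary_def)
  obtain r p m where r: "strict_mono r" "attracts (\<lambda>n. g (r n)) p m"
    by (rule subsequence[OF g(1,2)]) (rule that; assumption)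
  have "(\<lambda>n. g (r n)) \<longlonglongrightarrow> S"
    using LIMSEQ_subseq_LIMSEQ[OF g(3) r(1)] by (simp add: o_def)
  with r(2) show ?thesis by (rule sp_rank_attracts_limit)
qed

text \<open>A nonempty open set lies in no line, so a pointwise limit on it can be tested at one
  point off the repelling line. Conversely the complement of that line serves as the open
  set.\<close>

lemma attracting_points:
  "{p. \<exists>g :: nat \<Rightarrow> sp3. inj g \<and> range g \<subseteq> G \<and>
      (\<exists>U. open U \<and> U \<noteq> {} \<and> (\<forall>x\<in>U. (\<lambda>n. psl_act (g n) x) \<longlonglongrightarrow> p))} = fst ` flag_limit_set G"
proof (intro equalityI subsetI)
  fix p assume "p \<in> {p. \<exists>g :: nat \<Rightarrow> sp3. inj g \<and> range g \<subseteq> G \<and>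
      (\<exists>U. open U \<and> U \<noteq> {} \<and> (\<forall>x\<in>U. (\<lambda>n. psl_act (g n) x) \<longlonglongrightarrow> p))}"
  then obtain g :: "nat \<Rightarrow> sp3" and U x0 where g: "inj g" "range g \<subseteq> G" and U: "open U" "x0 \<in> U"
    and lim: "\<And>x. x \<in> U \<Longrightarrow> (\<lambda>n. psl_act (g n) x) \<longlonglongrightarrow> p"
    by blast
  obtain r p' l' m where r: "strict_mono r" "(p', l') \<in> flag_limit_set G" "attracts (\<lambda>n. g (r n)) p' m"
    by (rule subsequence[OF g]) (rule that; assumption)
  obtain x where x: "x \<in> U" "\<not> incident x m" using open_not_subset_line[OF U] .
  have "(\<lambda>n. psl_act (g (r n)) x) \<longlonglongrightarrow> p'"
    using attracts_tendsto[OF r(3) tendsto_const x(2)] .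
  moreover have "(\<lambda>n. psl_act (g (r n)) x) \<longlonglongrightarrow> p"
    using LIMSEQ_subseq_LIMSEQ[OF lim[OF x(1)] r(1)] by (simp add: o_def)
  ultimately have "p' = p" using LIMSEQ_unique by blast
  with r(2) show "p \<in> fst ` flag_limit_set G" by force
next
  fix p assume "p \<in> fst ` flag_limit_set G"
  then obtain l where "(p, l) \<in> flag_limit_set G" by auto
  then obtain g m where g: "inj g" "range g \<subseteq> G" "attracts g p m"
    by (rule flag_limit_sequence) (rule that; assumption)
  have "open (- line_of m)" using closed_line_of by (simp add: open_Compl)
  moreover have "- line_of m \<noteq> {}"
    using open_not_subset_line[of UNIV _ m] by (auto simp: line_of_def)
  moreover have "\<forall>x\<in>- line_of m. (\<lambda>n. psl_act (g n) x) \<longlonglongrightarrow> p"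
    using attracts_tendsto[OF g(3) tendsto_const] by (auto simp: line_of_def)
  ultimately show "p \<in> {p. \<exists>g :: nat \<Rightarrow> sp3. inj g \<and> range g \<subseteq> G \<and>
      (\<exists>U. open U \<and> U \<noteq> {} \<and> (\<forall>x\<in>U. (\<lambda>n. psl_act (g n) x) \<longlonglongrightarrow> p))}"
    using g by blast
qed

lemma contragredient_twice: "g \<in> G \<Longrightarrow> contragredient (contragredient g) = g"
  using in_carrier by (rule contragredient_carrier)

lemma inj_contragredient:
  assumes "inj g" "\<And>n. contragredient (contragredient (g n)) = g n"
  shows "inj (\<lambda>n. contragredient (g n))"
proof (rule injI)
  fix a b assume "contragredient (g a) = contragredient (g b)"
  then have "contragredient (contragredient (g a)) = contragredient (contragredient (g b))"
    by (rule arg_cong)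
  then show "a = b" using assms(1) unfolding assms(2) by (simp add: inj_eq)
qed

text \<open>Bidual identification: as \<open>contragredient\<close> is an involution, sequences of
  the contragredient group correspond to sequences of \<open>G\<close> under the original
  action.\<close>

lemma CoG_contragredient: "CoG_limit_set (contragredient ` G) = fst ` flag_limit_set G"
  unfolding attracting_points[symmetric] CoG_limit_set_def
proof (intro Collect_cong iffI; elim exE conjE)
  fix p U and h :: "nat \<Rightarrow> sp3"
  assume h: "inj h" "range h \<subseteq> contragredient ` G" and U: "open U" "U \<noteq> {}"
    "\<forall>x\<in>U. (\<lambda>n. psl_act (contragredient (h n)) x) \<longlonglongrightarrow> p"
  have "contragredient (h n) \<in> G" "contragredient (contragredient (h n)) = h n" for n
  proof -
    obtain k where "k \<in> G" "h n = contragredient k" using h(2) by blast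
    then show "contragredient (h n) \<in> G" "contragredient (contragredient (h n)) = h n"
      using contragredient_twice by simp_all
  qed
  then show "\<exists>g. inj g \<and> range g \<subseteq> G \<and> (\<exists>U. open U \<and> U \<noteq> {} \<and> (\<forall>x\<in>U. (\<lambda>n. psl_act (g n) x) \<longlonglongrightarrow> p))"
    using U inj_contragredient[OF h(1)] by (intro exI[of _ "\<lambda>n. contragredient (h n)"]) blast
next
  fix p U and g :: "nat \<Rightarrow> sp3"
  assume g: "inj g" "range g \<subseteq> G" and U: "open U" "U \<noteq> {}" "\<forall>x\<in>U. (\<lambda>n. psl_act (g n) x) \<longlonglongrightarrow> p"
  have twice: "contragredient (contragredient (g n)) = g n" for n
    using g(2) contragredient_twice by auto
  then have "inj (\<lambda>n. contragredient (g n))" using g(1) by (intro inj_contragredient)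
  moreover have "range (\<lambda>n. contragredient (g n)) \<subseteq> contragredient ` G" using g(2) by auto
  ultimately show "\<exists>h. inj h \<and> range h \<subseteq> contragredient ` G \<and> (\<exists>U. open U \<and> U \<noteq> {} \<and>
      (\<forall>x\<in>U. (\<lambda>n. psl_act (contragredient (h n)) x) \<longlonglongrightarrow> p))"
    using U twice by (intro exI[of _ "\<lambda>n. contragredient (g n)"]) auto
qed

text \<open>The dual form of \<open>attracting_points\<close>: contragredients collapse off the
  pencil of lines through \<open>q\<close>, and a pencil contains no nonempty open set of the dual
  plane.\<close>

lemma CoG_eq: "CoG_limit_set G = snd ` flag_limit_set G"
proof (intro equalityI subsetI)
  fix l assume "l \<in> CoG_limit_set G"
  then obtain g :: "nat \<Rightarrow> sp3" and U x0 where g: "inj g" "range g \<subseteq> G" and U: "open U" "x0 \<in> U"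
    and lim: "\<And>x. x \<in> U \<Longrightarrow> (\<lambda>n. psl_act (contragredient (g n)) x) \<longlonglongrightarrow> l"
    unfolding CoG_limit_set_def by blast
  obtain r p' l' q where r: "strict_mono r" "(p', l') \<in> flag_limit_set G"
    "attracts (\<lambda>n. contragredient (g (r n))) l' q"
    by (rule subsequence[OF g]) (rule that; assumption)
  obtain x where x: "x \<in> U" "\<not> incident x q" using open_not_subset_line[OF U] .
  have "(\<lambda>n. psl_act (contragredient (g (r n))) x) \<longlonglongrightarrow> l'"
    using attracts_tendsto[OF r(3) tendsto_const x(2)] .
  moreover have "(\<lambda>n. psl_act (contragredient (g (r n))) x) \<longlonglongrightarrow> l"
    using LIMSEQ_subseq_LIMSEQ[OF lim[OF x(1)] r(1)] by (simp add: o_def)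
  ultimately have "l' = l" using LIMSEQ_unique by blast
  with r(2) show "l \<in> snd ` flag_limit_set G" by force
next
  fix l assume "l \<in> snd ` flag_limit_set G"
  then obtain p where "(p, l) \<in> flag_limit_set G" by auto
  then obtain g q where g: "inj g" "range g \<subseteq> G" "attracts (\<lambda>n. contragredient (g n)) l q"
    by (rule flag_limit_sequence) (rule that; assumption)
  have "open (- line_of q)" using closed_line_of by (simp add: open_Compl)
  moreover have "- line_of q \<noteq> {}"
    using open_not_subset_line[of UNIV _ q] by (auto simp: line_of_def)
  moreover have "\<forall>x\<in>- line_of q. (\<lambda>n. psl_act (contragredient (g n)) x) \<longlonglongrightarrow> l"
    using attracts_tendsto[OF g(3) tendsto_const] by (auto simp: line_of_def)
  ultimately show "l \<in> CoG_limit_set G"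
    using g unfolding CoG_limit_set_def by blast
qed

section \<open>The union of the limit lines and the normality domain\<close>

abbreviation "Th \<equiv> Th_inc (flag_limit_set G)"

text \<open>Diagonal argument: distinct elements are chosen whose singular flags approach the flags
  \<open>(p n, l n)\<close>. A subsequence has a limit flag, to which the lines \<open>l n\<close>
  converge along with it.\<close>

lemma closed_Th: "closed Th"
  unfolding closed_sequential_limits
proof (intro allI impI, elim conjE)
  fix y z assume y: "\<forall>n. y n \<in> Th" "y \<longlonglongrightarrow> z"
  then obtain p l where pl: "\<And>n. (p n, l n) \<in> flag_limit_set G" "\<And>n. incident (y n) (l n)"
    unfolding mem_Th_inc by metis
  have "infinite {g \<in> G. dist (left_singular_flag g) (p n, l n) < inverse (real (Suc n))}" for n
  proof -
    obtain g where g: "inj g" "range g \<subseteq> G" "(\<lambda>n. left_singular_flag (g n)) \<longlonglongrightarrow> (p n, l n)"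
      using pl(1)[of n] by (auto simp: flag_limit_set_def)
    show ?thesis
      by (rule infinite_hits[OF g(1,2)]) (rule tendstoD[OF g(3)], simp)
  qed
  then obtain h where "inj h" and
    hmem: "\<And>n. h n \<in> {g \<in> G. dist (left_singular_flag g) (p n, l n) < inverse (real (Suc n))}"
    using injective_selection[of "\<lambda>n. {g \<in> G. dist (left_singular_flag g) (p n, l n) < inverse (real (Suc n))}"] by blast
  then have h: "inj h" "range h \<subseteq> G" "\<And>n. dist (left_singular_flag (h n)) (p n, l n) < inverse (real (Suc n))"
    by auto
  obtain r p' l' where r: "strict_mono r" "(p', l') \<in> flag_limit_set G"
    "(\<lambda>n. left_singular_flag (h (r n))) \<longlonglongrightarrow> (p', l')"
    by (rule subsequence[OF h(1,2)]) (rule that; assumption)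
  have "(\<lambda>n. (p (r n), l (r n))) \<longlonglongrightarrow> (p', l')"
  proof (rule tendsto_of_dist[OF r(3)])
    fix n
    have "inverse (real (Suc (r n))) \<le> inverse (real (Suc n))"
      using seq_suble[OF r(1), of n] by (simp add: field_simps)
    then show "dist (left_singular_flag (h (r n))) (p (r n), l (r n)) < inverse (real (Suc n))"
      using h(3)[of "r n"] by linarith
  qed
  then have "(\<lambda>n. l (r n)) \<longlonglongrightarrow> l'" by (auto dest: tendsto_snd)
  moreover have "(\<lambda>n. y (r n)) \<longlonglongrightarrow> z"
    using LIMSEQ_subseq_LIMSEQ[OF y(2) r(1)] by (simp add: o_def)
  ultimately have "incident z l'" using incident_limit pl(2) by blast
  with r(2) show "z \<in> Th" unfolding mem_Th_inc by blast
qed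

text \<open>Near \<open>x\<close> the inverses behave in two ways: points off \<open>l\<close> go to
  \<open>q\<close>, while other points arbitrarily close to \<open>x\<close> are sent onto a fixed
  line missing \<open>q\<close>.\<close>

lemma not_equicontinuous_on_Th:
  assumes "x \<in> Th"
  shows "\<not> equicontinuous_at G x"
proof
  assume eq: "equicontinuous_at G x"
  obtain p l where pl: "(p, l) \<in> flag_limit_set G" "incident x l"
    using assms unfolding mem_Th_inc by blast
  obtain g q m where g: "inj g" "range g \<subseteq> G"
    and att: "attracts (\<lambda>n. inv\<^bsub>PSL3\<^esub> g n) q l" "attracts (\<lambda>n. contragredient (g n)) l q"
    by (rule flag_limit_sequence[OF pl(1)]) (rule that; assumption)
  have gG: "g n \<in> G" for n using g(2) by auto
  \<comment> \<open>Points and lines exchange roles here: \<open>k\<close> is a point of the dual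
    plane off the pencil \<open>q\<close>.\<close>
  obtain k where k: "\<not> incident q k"
    using open_not_subset_line[of UNIV undefined q] by (auto simp: incident_commute)
  have "open (- line_of k)" "q \<in> - line_of k"
    using closed_line_of k by (simp_all add: open_Compl line_of_def)
  then obtain e where e0: "e > 0" "\<And>y. dist y q < e \<Longrightarrow> y \<in> - line_of k"
    by (metis open_dist)
  then have e: "e > 0" "\<And>y. dist y q < e \<Longrightarrow> \<not> incident y k"
    by (auto simp: line_of_def)
  \<comment> \<open>Three comparisons have to fit into the ball about \<open>q\<close> that misses
    \<open>k\<close>: the image of \<open>z n\<close> with that of \<open>x\<close>, the image of
    \<open>x\<close> with that of \<open>y\<close>, and the latter with \<open>q\<close>.\<close>
  have "e / 3 > 0" using e(1) by simp
  then obtain d where d: "d > 0"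
    "\<And>h y. h \<in> G \<Longrightarrow> dist y x < d \<Longrightarrow> dist (psl_act h y) (psl_act h x) < e / 3"
    using eq unfolding equicontinuous_at_def by meson
  obtain y where y: "dist x y < d" "\<not> incident y l"
    using open_not_subset_line[of "ball x d" x l] d(1) by auto
  let ?h = "\<lambda>n. inv\<^bsub>PSL3\<^esub> g n"
  have "(\<lambda>n. psl_act (?h n) y) \<longlonglongrightarrow> q"
    using attracts_tendsto[OF att(1) tendsto_const y(2)] .
  then have ev1: "eventually (\<lambda>n. dist (psl_act (?h n) y) q < e / 3) sequentially"
    using e(1) by (intro tendstoD) auto
  \<comment> \<open>The images of \<open>k\<close> tend to \<open>l\<close>, so \<open>x\<close> is
    a limit of points on them; the inverses carry these points back onto \<open>k\<close>.\<close>
  have "(\<lambda>n. psl_act (contragredient (g n)) k) \<longlonglongrightarrow> l"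
    using attracts_tendsto[OF att(2) tendsto_const] k incident_commute by blast
  then obtain z where z: "z \<longlonglongrightarrow> x"
    "eventually (\<lambda>n. incident (z n) (psl_act (contragredient (g n)) k)) sequentially"
    using pl(2) by (rule incident_approximation)
  have ev2: "eventually (\<lambda>n. dist (z n) x < d) sequentially"
    using z(1) d(1) by (rule tendstoD)
  from ev1 z(2) ev2 have "eventually (\<lambda>n. False) sequentially"
  proof eventually_elim
    case (elim n)
    have c: "g n \<in> carrier PSL3" using gG in_carrier by blast
    have "incident (psl_act (g n) (psl_act (?h n) (z n))) (psl_act (contragredient (g n)) k)"
      using elim psl_act_inv(2)[OF c] by simp
    then have "incident (psl_act (?h n) (z n)) k"
      using incident_psl_act[OF c] by blast
    moreover have "dist (psl_act (?h n) (z n)) (psl_act (?h n) x) < e / 3"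
      using d(2)[OF inv_in[OF gG]] elim by blast
    moreover have "dist (psl_act (?h n) y) (psl_act (?h n) x) < e / 3"
      using d(2)[OF inv_in[OF gG], of y n] y(1) by (simp only: dist_commute)
    ultimately show ?case
      using e(2)[of "psl_act (?h n) (z n)"] elim(1)
        dist_triangle[of "psl_act (?h n) (z n)" q "psl_act (?h n) x"]
        dist_triangle[of "psl_act (?h n) x" q "psl_act (?h n) y"]
      by (simp add: dist_commute)
  qed
  then show False by simp
qed

text \<open>A failure must involve infinitely many elements at each scale, as continuity handles
  finitely many. Along a subsequence \<open>y\<close> and points converging to it are then attracted
  to the same \<open>p\<close>.\<close>

lemma equicontinuous_off_Th:
  assumes "y \<notin> Th"
  shows "equicontinuous_at G y"
proof (rule ccontr)
  assume "\<not> equicontinuous_at G y"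
  then obtain e where e: "e > 0"
    "\<And>d. d > 0 \<Longrightarrow> \<exists>g\<in>G. \<exists>z. dist z y < d \<and> dist (psl_act g z) (psl_act g y) \<ge> e"
    unfolding equicontinuous_at_def by (meson linorder_not_less)
  define S where "S d = {g \<in> G. \<exists>z. dist z y < d \<and> dist (psl_act g z) (psl_act g y) \<ge> e}" for d
  have "infinite (S d)" if "d > 0" for d
  proof
    assume fin: "finite (S d)"
    have "\<exists>c>0. \<forall>z. dist z y < c \<longrightarrow> dist (psl_act g z) (psl_act g y) < e" if "g \<in> S d" for g
    proof -
      have "isCont (psl_act g) y" using that in_carrier by (intro isCont_psl_act) (auto simp: S_def)
      then show ?thesis using e(1) unfolding continuous_at_eps_delta by blast
    qed
    then obtain c where c: "\<And>g. g \<in> S d \<Longrightarrow> c g > 0"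
      "\<And>g z. g \<in> S d \<Longrightarrow> dist z y < c g \<Longrightarrow> dist (psl_act g z) (psl_act g y) < e"
      by metis
    \<comment> \<open>A radius at which none of the supposedly finitely many offenders can offend;
      including \<open>d\<close> keeps new offenders inside \<open>S d\<close>.\<close>
    define b where "b = Min (insert d (c ` S d))"
    have b: "b > 0" "b \<le> d" "\<And>g. g \<in> S d \<Longrightarrow> b \<le> c g"
      using fin c(1) \<open>d > 0\<close> by (auto simp: b_def)
    obtain g z where gz: "g \<in> G" "dist z y < b" "dist (psl_act g z) (psl_act g y) \<ge> e"
      using e(2)[OF b(1)] by blast
    then have "g \<in> S d" using b(2) by (force simp: S_def)
    then show False using c(2)[of g z] b(3)[of g] gz by fastforce
  qed
  then have inf: "\<And>n. infinite (S (inverse (real (Suc n))))" by simp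
  obtain g where "inj g" and gS: "\<And>n. g n \<in> S (inverse (real (Suc n)))"
    using injective_selection[of "\<lambda>n. S (inverse (real (Suc n)))", OF inf] by blast
  then have g: "inj g" "range g \<subseteq> G" by (auto simp: S_def)
  have "\<exists>z. dist z y < inverse (real (Suc n)) \<and> dist (psl_act (g n) z) (psl_act (g n) y) \<ge> e" for n
    using gS[of n] by (simp add: S_def)
  then obtain z where z: "\<And>n. dist (z n) y < inverse (real (Suc n))"
    "\<And>n. dist (psl_act (g n) (z n)) (psl_act (g n) y) \<ge> e"
    by metis
  have "z \<longlonglongrightarrow> y"
    by (rule tendsto_of_dist[OF tendsto_const]) (use z(1) in \<open>simp add: dist_commute\<close>)
  obtain r p q m where r: "strict_mono r" "(q, m) \<in> flag_limit_set G" "attracts (\<lambda>n. g (r n)) p m"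
    by (rule subsequence[OF g]) (rule that; assumption)
  have ym: "\<not> incident y m" using assms r(2) unfolding mem_Th_inc by blast
  have "(\<lambda>n. z (r n)) \<longlonglongrightarrow> y"
    using LIMSEQ_subseq_LIMSEQ[OF \<open>z \<longlonglongrightarrow> y\<close> r(1)] by (simp add: o_def)
  then have "(\<lambda>n. psl_act (g (r n)) (z (r n))) \<longlonglongrightarrow> p"
    using attracts_tendsto[OF r(3) _ ym] by blast
  moreover have "(\<lambda>n. psl_act (g (r n)) y) \<longlonglongrightarrow> p"
    using attracts_tendsto[OF r(3) tendsto_const ym] .
  ultimately have "(\<lambda>n. dist (psl_act (g (r n)) (z (r n))) (psl_act (g (r n)) y)) \<longlonglongrightarrow> dist p p"
    by (rule tendsto_dist)
  then have "e \<le> dist p p"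
    by (rule tendsto_lowerbound) (use z(2) in auto)
  then show False using e(1) by simp
qed

lemma equicontinuous_iff: "equicontinuous_at G x \<longleftrightarrow> x \<notin> Th"
  using not_equicontinuous_on_Th equicontinuous_off_Th by blast

text \<open>Closedness of the union supplies the neighbourhood that the definition of
  \<open>Eq_set\<close> demands.\<close>

lemma Eq_set_eq: "Eq_set G = - Th"
  using closed_Th unfolding Eq_set_def equicontinuous_iff by (auto intro: open_Compl)

text \<open>Equicontinuity is transported instead of flags: near \<open>psl_act g x\<close> the map
  \<open>h\<close> is the product of \<open>h\<close> and \<open>g\<close> applied near
  \<open>x\<close>, after the continuous inverse of \<open>g\<close>.\<close>

lemma Th_invariant:
  assumes g: "g \<in> G"
  shows "psl_act g x \<in> Th \<longleftrightarrow> x \<in> Th"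
proof -
  have out: "psl_act g x \<notin> Th" if xg: "x \<notin> Th" "g \<in> G" for x g
    unfolding equicontinuous_iff[symmetric] equicontinuous_at_def
  proof (intro allI impI)
    fix e :: real assume "e > 0"
    then obtain d where d: "d > 0"
      "\<And>h y. h \<in> G \<Longrightarrow> dist y x < d \<Longrightarrow> dist (psl_act h y) (psl_act h x) < e"
      using equicontinuous_off_Th[OF xg(1)] \<open>e > 0\<close> unfolding equicontinuous_at_def by meson
    have c: "g \<in> carrier PSL3" using xg in_carrier by blast
    have "isCont (psl_act (inv\<^bsub>PSL3\<^esub> g)) (psl_act g x)"
      using c by (intro isCont_psl_act) simp
    then obtain d' where d': "d' > 0" "\<And>y. dist y (psl_act g x) < d' \<Longrightarrow>
        dist (psl_act (inv\<^bsub>PSL3\<^esub> g) y) x < d"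
      using d(1) psl_act_inv(1)[OF c] unfolding continuous_at_eps_delta by metis
    have "dist (psl_act h y) (psl_act h (psl_act g x)) < e"
      if "h \<in> G" "dist y (psl_act g x) < d'" for h y
      using d(2)[OF mult_in[OF that(1) \<open>g \<in> G\<close>] d'(2)[OF that(2)]] that in_carrier c
      by (simp add: psl_act_mult psl_act_inv)
    with d'(1) show "\<exists>d>0. \<forall>h\<in>G. \<forall>y. dist y (psl_act g x) < d \<longrightarrow>
        dist (psl_act h y) (psl_act h (psl_act g x)) < e"
      by blast
  qed
  from out[of x g] out[of "psl_act g x" "inv\<^bsub>PSL3\<^esub> g"] show ?thesis
    using g inv_in in_carrier psl_act_inv(1) by metis
qed

text \<open>Infinitely many collisions would send convergent points of \<open>K\<close> to an
  attracting point \<open>p\<close> in \<open>K\<close>; but \<open>p\<close> lies on its own limit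
  line.\<close>

lemma properly_discontinuous_off_Th: "properly_discontinuous_on G (- Th)"
  unfolding properly_discontinuous_on_def
proof (intro conjI ballI allI impI)
  show "psl_act g ` (- Th) \<subseteq> - Th" if "g \<in> G" for g
    using Th_invariant[OF that] by auto
  fix K assume K: "compact K \<and> K \<subseteq> - Th"
  show "finite {g \<in> G. psl_act g ` K \<inter> K \<noteq> {}}"
  proof (rule ccontr)
    assume "infinite {g \<in> G. psl_act g ` K \<inter> K \<noteq> {}}"
    then obtain g where "inj g" and gK: "\<And>n::nat. g n \<in> {g \<in> G. psl_act g ` K \<inter> K \<noteq> {}}"
      using injective_selection[of "\<lambda>_. {g \<in> G. psl_act g ` K \<inter> K \<noteq> {}}"] by blast
    then have g: "inj g" "range g \<subseteq> G" by auto
    have "\<exists>z. z \<in> K \<and> psl_act (g n) z \<in> K" for n using gK[of n] by blast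
    then obtain z where z: "\<And>n. z n \<in> K" "\<And>n. psl_act (g n) (z n) \<in> K" by metis
    obtain z' s where s: "z' \<in> K" "strict_mono s" "(z \<circ> s) \<longlonglongrightarrow> z'"
      using K z(1) compact_imp_seq_compact seq_compactE by metis
    have gs: "inj (\<lambda>n. g (s n))" "range (\<lambda>n. g (s n)) \<subseteq> G"
      using g s(2) by (auto intro: inj_subsequence)
    obtain r p l q m where r: "strict_mono r" "incident p l" "(p, l) \<in> flag_limit_set G"
        "(q, m) \<in> flag_limit_set G" "attracts (\<lambda>n. g (s (r n))) p m"
      by (rule subsequence[OF gs]) (rule that; assumption)
    have "\<not> incident z' m" using K s(1) r(4) mem_Th_inc by blast
    moreover have "(\<lambda>n. z (s (r n))) \<longlonglongrightarrow> z'"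
      using LIMSEQ_subseq_LIMSEQ[OF s(3) r(1)] by (simp add: o_def)
    ultimately have "(\<lambda>n. psl_act (g (s (r n))) (z (s (r n)))) \<longlonglongrightarrow> p"
      using attracts_tendsto[OF r(5)] by blast
    then have "p \<in> K"
      using K z(2) closed_sequentially[OF compact_imp_closed, of K "\<lambda>n. psl_act (g (s (r n))) (z (s (r n)))" p]
      by blast
    moreover have "p \<in> Th" using r(2,3) mem_Th_inc by blast
    ultimately show False using K by blast
  qed
qed

section \<open>The Kulkarni limit set\<close>

lemma finite_collisions:
  assumes "compact K" "K \<inter> Th = {}"
  shows "finite {g \<in> G. psl_act g ` K \<inter> K \<noteq> {}}"
  using properly_discontinuous_off_Th assms unfolding properly_discontinuous_on_def by blast

lemma Kul_L0_subset: "Kul_L0 G \<subseteq> Th"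
proof -
  have "z \<in> Th" if "infinite {g \<in> G. psl_act g z = z}" for z
  proof (rule ccontr)
    assume "z \<notin> Th"
    then have "finite {g \<in> G. psl_act g ` {z} \<inter> {z} \<noteq> {}}"
      by (intro finite_collisions) auto
    moreover have "{g \<in> G. psl_act g ` {z} \<inter> {z} \<noteq> {}} = {g \<in> G. psl_act g z = z}" by auto
    ultimately show False using that by simp
  qed
  then show ?thesis
    unfolding Kul_L0_def using closed_Th by (intro closure_minimal) auto
qed

lemma Kul_L1_subset: "Kul_L1 G \<subseteq> Th"
proof -
  have "y \<in> Th" if lim: "y islimpt ((\<lambda>g. psl_act g z) ` G)" for y z
  proof (cases "z \<in> Th")
    \<comment> \<open>A point outside \<open>Kul_L0\<close> may still lie on a limit line; there
      invariance and closedness of the union replace the dynamics.\<close>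
    case True
    then have "(\<lambda>g. psl_act g z) ` G \<subseteq> Th" using Th_invariant by blast
    then have "y islimpt Th" using lim islimpt_subset by blast
    then show ?thesis using closed_Th closed_limpt by blast
  next
    case False
    define S where "S n = {g \<in> G. dist y (psl_act g z) < inverse (real (Suc n))}" for n
    have "infinite (S n)" for n
    proof
      assume "finite (S n)"
      moreover have "(\<lambda>g. psl_act g z) ` G \<inter> ball y (inverse (real (Suc n))) \<subseteq> (\<lambda>g. psl_act g z) ` S n"
        by (auto simp: S_def)
      ultimately have "finite ((\<lambda>g. psl_act g z) ` G \<inter> ball y (inverse (real (Suc n))))"
        using finite_surj by blast
      moreover have "inverse (real (Suc n)) > 0" by simp
      ultimately show False using lim unfolding islimpt_eq_infinite_ball by blast
    qed
    then obtain g where "inj g" "\<And>n. g n \<in> S n"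
      using injective_selection[of S] by blast
    then have g: "inj g" "range g \<subseteq> G" "\<And>n. dist y (psl_act (g n) z) < inverse (real (Suc n))"
      by (auto simp: S_def)
    have to_y: "(\<lambda>n. psl_act (g n) z) \<longlonglongrightarrow> y"
      using g(3) by (rule tendsto_of_dist[OF tendsto_const])
    obtain r p l q m where r: "strict_mono r" "incident p l" "(p, l) \<in> flag_limit_set G"
        "(q, m) \<in> flag_limit_set G" "attracts (\<lambda>n. g (r n)) p m"
      by (rule subsequence[OF g(1,2)]) (rule that; assumption)
    have "\<not> incident z m" using False r(4) mem_Th_inc by blast
    then have "(\<lambda>n. psl_act (g (r n)) z) \<longlonglongrightarrow> p"
      using attracts_tendsto[OF r(5) tendsto_const] by blast
    moreover have "(\<lambda>n. psl_act (g (r n)) z) \<longlonglongrightarrow> y"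
      using LIMSEQ_subseq_LIMSEQ[OF to_y r(1)] by (simp add: o_def)
    ultimately have "y = p" using LIMSEQ_unique by blast
    then show ?thesis using r(2,3) mem_Th_inc by blast
  qed
  then show ?thesis
    unfolding Kul_L1_def using closed_Th by (intro closure_minimal) auto
qed

text \<open>Convergence of \<open>g n\<close> applied to \<open>z\<close> does not yet make
  \<open>p\<close> an accumulation point of the orbit as a set. If only finitely many orbit points
  were near \<open>p\<close>, infinitely many elements would map \<open>z\<close> into a finite set
  off the limit lines, against proper discontinuity.\<close>

lemma attracting_point_in_Kul_L1:
  assumes z: "z \<notin> Th" and "(p, l) \<in> flag_limit_set G"
  shows "p \<in> Kul_L1 G"
proof -
  obtain g q m where g: "inj g" "range g \<subseteq> G" "(q, m) \<in> flag_limit_set G" "attracts g p m"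
    by (rule flag_limit_sequence[OF assms(2)]) (rule that; assumption)
  have "\<not> incident z m" using z g(3) mem_Th_inc by blast
  then have lim: "(\<lambda>n. psl_act (g n) z) \<longlonglongrightarrow> p"
    using attracts_tendsto[OF g(4) tendsto_const] by blast
  let ?O = "(\<lambda>g. psl_act g z) ` G"
  have "infinite (?O \<inter> ball p e)" if "e > 0" for e
  proof
    assume fin: "finite (?O \<inter> ball p e)"
    \<comment> \<open>Adding \<open>z\<close> makes every element that sends \<open>z\<close> into
      the ball a self-collision of \<open>?K\<close>.\<close>
    let ?K = "insert z (?O \<inter> ball p e)"
    have "?K \<inter> Th = {}" using z Th_invariant by auto
    with fin have "finite {g \<in> G. psl_act g ` ?K \<inter> ?K \<noteq> {}}"
      by (intro finite_collisions finite_imp_compact) auto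
    moreover have "infinite {x \<in> G. dist (psl_act x z) p < e}"
      by (rule infinite_hits[OF g(1,2)]) (rule tendstoD[OF lim \<open>e > 0\<close>])
    moreover have "{x \<in> G. dist (psl_act x z) p < e} \<subseteq> {g \<in> G. psl_act g ` ?K \<inter> ?K \<noteq> {}}"
      by (auto simp: dist_commute)
    ultimately show False using finite_subset by blast
  qed
  then have "p islimpt ?O" by (simp add: islimpt_eq_infinite_ball)
  moreover have "z \<notin> Kul_L0 G" using z Kul_L0_subset by blast
  ultimately have "p \<in> {y. \<exists>z. z \<notin> Kul_L0 G \<and> y islimpt (\<lambda>g. psl_act g z) ` G}" by blast
  then show ?thesis
    unfolding Kul_L1_def by (rule subsetD[OF closure_subset])
qed

text \<open>If \<open>g\<^sub>n x\<^sub>n\<close> stays away from the attracting line, the inverses move it to the attracting point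
  \<open>q\<close> of \<open>g\<^sub>n\<^sup>-\<^sup>1\<close>, so \<open>x\<^sub>n\<close> can only accumulate at \<open>q\<close>, which lies in \<open>L\<^sub>1\<close>.\<close>

lemma Kul_L2_subset: "Kul_L2 G \<subseteq> Th"
proof -
  have "y \<in> Th" if K: "compact K" "K \<inter> (Kul_L0 G \<union> Kul_L1 G) = {}"
    and acc: "\<And>U. open U \<Longrightarrow> y \<in> U \<Longrightarrow> infinite {g \<in> G. psl_act g ` K \<inter> U \<noteq> {}}" for y K
  proof (rule ccontr)
    assume y: "y \<notin> Th"
    define S where "S n = {g \<in> G. psl_act g ` K \<inter> ball y (inverse (real (Suc n))) \<noteq> {}}" for n
    have "infinite (S n)" for n
      unfolding S_def by (rule acc) auto
    then obtain g where "inj g" and gS: "\<And>n. g n \<in> S n"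
      using injective_selection[of S] by blast
    then have g: "inj g" "range g \<subseteq> G" by (auto simp: S_def)
    have "\<exists>x. x \<in> K \<and> dist y (psl_act (g n) x) < inverse (real (Suc n))" for n
      using gS[of n] by (auto simp: S_def)
    then obtain x where x: "\<And>n. x n \<in> K" "\<And>n. dist y (psl_act (g n) (x n)) < inverse (real (Suc n))"
      by metis
    have to_y: "(\<lambda>n. psl_act (g n) (x n)) \<longlonglongrightarrow> y"
      using x(2) by (rule tendsto_of_dist[OF tendsto_const])
    obtain x' s where s: "x' \<in> K" "strict_mono s" "(x \<circ> s) \<longlonglongrightarrow> x'"
      using K(1) x(1) compact_imp_seq_compact seq_compactE by metis
    have gs: "inj (\<lambda>n. g (s n))" "range (\<lambda>n. g (s n)) \<subseteq> G"
      using g s(2) by (auto intro: inj_subsequence)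
    obtain r p l q m where r: "strict_mono r" "(p, l) \<in> flag_limit_set G" "(q, m) \<in> flag_limit_set G"
        "attracts (\<lambda>n. inv\<^bsub>PSL3\<^esub> g (s (r n))) q l"
      by (rule subsequence[OF gs]) (rule that; assumption)
    have sr: "strict_mono (s \<circ> r)" using s(2) r(1) by (rule strict_mono_o)
    have "(\<lambda>n. psl_act (g (s (r n))) (x (s (r n)))) \<longlonglongrightarrow> y"
      using LIMSEQ_subseq_LIMSEQ[OF to_y sr] by (simp add: o_def)
    moreover have "\<not> incident y l" using y r(2) mem_Th_inc by blast
    ultimately have "(\<lambda>n. psl_act (inv\<^bsub>PSL3\<^esub> g (s (r n))) (psl_act (g (s (r n))) (x (s (r n))))) \<longlonglongrightarrow> q"
      by (rule attracts_tendsto[OF r(4)])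
    moreover have "g (s (r n)) \<in> carrier PSL3" for n using g(2) in_carrier by auto
    ultimately have "(\<lambda>n. x (s (r n))) \<longlonglongrightarrow> q" by (simp add: psl_act_inv)
    moreover have "(\<lambda>n. x (s (r n))) \<longlonglongrightarrow> x'"
      using LIMSEQ_subseq_LIMSEQ[OF s(3) r(1)] by (simp add: o_def)
    ultimately have "x' = q" using LIMSEQ_unique by blast
    then have "x' \<in> Kul_L1 G" using attracting_point_in_Kul_L1[OF y r(3)] by simp
    with K(2) s(1) show False by blast
  qed
  then show ?thesis
    unfolding Kul_L2_def using closed_Th by (intro closure_minimal) blast+
qed

section \<open>Closedness and invariance of the Kulkarni limit set\<close>

lemma closed_Kul: "closed (Kul_limit_set G)"
  unfolding Kul_limit_set_def Kul_L0_def Kul_L1_def Kul_L2_def by (intro closed_Un closed_closure)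

text \<open>All three Kulkarni pieces are closures, so invariance need only be checked before
  closing up.\<close>

lemma psl_act_image_closure:
  assumes "g \<in> G" "\<And>y. y \<in> S \<Longrightarrow> psl_act g y \<in> S" "y \<in> closure S"
  shows "psl_act g y \<in> closure S"
proof -
  have "continuous_on (closure S) (psl_act g)"
    using isCont_psl_act[OF in_carrier[OF assms(1)]] by (intro continuous_at_imp_continuous_on) blast
  then have "psl_act g ` closure S \<subseteq> closure S"
    using assms(2) closure_subset by (intro image_closure_subset) blast+
  with assms(3) show ?thesis by blast
qed

text \<open>Conjugation by \<open>g\<close> embeds the stabiliser of \<open>z\<close> into that of
  its image.\<close>

lemma Kul_L0_invariant:
  assumes g: "g \<in> G" and "y \<in> Kul_L0 G"
  shows "psl_act g y \<in> Kul_L0 G"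
  using assms(2) unfolding Kul_L0_def
proof (rule psl_act_image_closure[OF g, rotated])
  fix z assume z: "z \<in> {z. infinite {h \<in> G. psl_act h z = z}}"
  have c: "g \<in> carrier PSL3" using g in_carrier by blast
  let ?f = "\<lambda>h. g \<otimes>\<^bsub>PSL3\<^esub> h \<otimes>\<^bsub>PSL3\<^esub> inv\<^bsub>PSL3\<^esub> g"
  have "inj_on ?f G"
    using c in_carrier by (intro inj_onI) simp
  then have "infinite (?f ` {h \<in> G. psl_act h z = z})"
    using z finite_imageD inj_on_subset by (metis (no_types, lifting) mem_Collect_eq subsetI)
  moreover have "?f ` {h \<in> G. psl_act h z = z} \<subseteq> {h \<in> G. psl_act h (psl_act g z) = psl_act g z}"
    using g c in_carrier by (auto simp: mult_in inv_in psl_act_mult psl_act_inv)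
  ultimately show "psl_act g z \<in> {z. infinite {h \<in> G. psl_act h z = z}}"
    using finite_subset by auto
qed

text \<open>\<open>g\<close> is injective, continuous and maps the orbit into itself, so the same
  \<open>z\<close> witnesses the image point.\<close>

lemma Kul_L1_invariant:
  assumes g: "g \<in> G" and "y \<in> Kul_L1 G"
  shows "psl_act g y \<in> Kul_L1 G"
  using assms(2) unfolding Kul_L1_def
proof (rule psl_act_image_closure[OF g, rotated])
  fix w assume "w \<in> {y. \<exists>z. z \<notin> Kul_L0 G \<and> y islimpt (\<lambda>g. psl_act g z) ` G}"
  then obtain z where z: "z \<notin> Kul_L0 G" "w islimpt (\<lambda>g. psl_act g z) ` G" by blast
  let ?O = "(\<lambda>g. psl_act g z) ` G"
  have c: "g \<in> carrier PSL3" using g in_carrier by blast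
  have inj: "inj (psl_act g)" using psl_act_inv(1)[OF c] by (metis injI)
  have "infinite (?O \<inter> ball (psl_act g w) e)" if "e > 0" for e
  proof -
    obtain d where d: "d > 0" "\<And>y. dist w y < d \<Longrightarrow> dist (psl_act g w) (psl_act g y) < e"
      using isCont_psl_act[OF c, of w] \<open>e > 0\<close> unfolding continuous_at_eps_delta
      by (metis dist_commute)
    have "infinite (psl_act g ` (?O \<inter> ball w d))"
      using z(2) d(1) inj finite_imageD inj_on_subset unfolding islimpt_eq_infinite_ball by blast
    moreover have "psl_act g (psl_act h z) \<in> ?O" if "h \<in> G" for h
      using mult_in[OF g that] psl_act_mult[OF c in_carrier[OF that]] by (metis image_eqI)
    then have "psl_act g ` (?O \<inter> ball w d) \<subseteq> ?O \<inter> ball (psl_act g w) e"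
      using d(2) by auto
    ultimately show ?thesis using finite_subset by blast
  qed
  then have "psl_act g w islimpt ?O" by (simp add: islimpt_eq_infinite_ball)
  with z(1) show "psl_act g w \<in> {y. \<exists>z. z \<notin> Kul_L0 G \<and> y islimpt (\<lambda>g. psl_act g z) ` G}" by blast
qed

text \<open>Left multiplication by \<open>g\<close> moves the images and leaves \<open>K\<close>
  alone, so the same compact set is a witness.\<close>

lemma Kul_L2_invariant:
  assumes g: "g \<in> G" and "y \<in> Kul_L2 G"
  shows "psl_act g y \<in> Kul_L2 G"
  using assms(2) unfolding Kul_L2_def
proof (rule psl_act_image_closure[OF g, rotated])
  let ?A = "\<lambda>K U. {g \<in> G. psl_act g ` K \<inter> U \<noteq> {}}"
  let ?S = "{y. \<exists>K. compact K \<and> K \<inter> (Kul_L0 G \<union> Kul_L1 G) = {} \<and> (\<forall>U. open U \<and> y \<in> U \<longrightarrow> infinite (?A K U))}"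
  fix w assume "w \<in> ?S"
  then obtain K where K: "compact K" "K \<inter> (Kul_L0 G \<union> Kul_L1 G) = {}"
    "\<And>U. open U \<Longrightarrow> w \<in> U \<Longrightarrow> infinite (?A K U)"
    by blast
  have c: "g \<in> carrier PSL3" using g in_carrier by blast
  have "infinite (?A K U)" if U: "open U" "psl_act g w \<in> U" for U
  proof -
    have "open (psl_act g -` U)"
      using U(1) isCont_psl_act[OF c] by (intro continuous_open_vimage) auto
    then have "infinite (?A K (psl_act g -` U))" using K(3) U(2) by blast
    moreover have "inj_on (\<lambda>h. g \<otimes>\<^bsub>PSL3\<^esub> h) (?A K (psl_act g -` U))"
      using c in_carrier by (intro inj_onI) simp
    ultimately have "infinite ((\<lambda>h. g \<otimes>\<^bsub>PSL3\<^esub> h) ` ?A K (psl_act g -` U))"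
      using finite_imageD by blast
    moreover have "(\<lambda>h. g \<otimes>\<^bsub>PSL3\<^esub> h) ` ?A K (psl_act g -` U) \<subseteq> ?A K U"
    proof (rule image_subsetI)
      fix h assume "h \<in> ?A K (psl_act g -` U)"
      then obtain x where x: "h \<in> G" "x \<in> K" "psl_act g (psl_act h x) \<in> U" by blast
      then have "psl_act (g \<otimes>\<^bsub>PSL3\<^esub> h) x \<in> U" using psl_act_mult[OF c in_carrier] by simp
      with x mult_in[OF g x(1)] show "g \<otimes>\<^bsub>PSL3\<^esub> h \<in> ?A K U" by blast
    qed
    ultimately show ?thesis using finite_subset by blast
  qed
  with K(1,2) show "psl_act g w \<in> ?S" by blast
qed

lemma Kul_invariant: "g \<in> G \<Longrightarrow> y \<in> Kul_limit_set G \<Longrightarrow> psl_act g y \<in> Kul_limit_set G"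
  unfolding Kul_limit_set_def by (auto intro: Kul_L0_invariant Kul_L1_invariant Kul_L2_invariant)

text \<open>Among three lines without a common point one, \<open>k\<close>, misses \<open>q\<close>,
  so its images under the sequence tend to \<open>l\<close>. These images lie in the invariant
  Kulkarni set, and closedness passes this on to every point of \<open>l\<close>.\<close>

lemma Th_subset_Kul:
  assumes A: "3 \<le> card A" "lines_in_general_position A" "\<And>l. l \<in> A \<Longrightarrow> line_of l \<subseteq> Kul_limit_set G"
  shows "Th \<subseteq> Kul_limit_set G"
proof
  fix x assume "x \<in> Th"
  then obtain p l where pl: "(p, l) \<in> flag_limit_set G" "incident x l"
    unfolding mem_Th_inc by blast
  obtain g q where g: "range g \<subseteq> G" "attracts (\<lambda>n. contragredient (g n)) l q"
    by (rule flag_limit_sequence[OF pl(1)]) (rule that; assumption)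
  obtain B where "B \<subseteq> A" "card B = 3" using A(1) by (meson obtain_subset_with_card_n)
  then obtain a b c where abc: "a \<in> A" "b \<in> A" "c \<in> A" "a \<noteq> b" "a \<noteq> c" "b \<noteq> c"
    unfolding card_3_iff by blast
  then have "line_of a \<inter> line_of b \<inter> line_of c = {}"
    using A(2) unfolding lines_in_general_position_def by blast
  then obtain k where k: "k \<in> A" "\<not> incident q k"
    using abc unfolding line_of_def by blast
  have "(\<lambda>n. psl_act (contragredient (g n)) k) \<longlonglongrightarrow> l"
    using attracts_tendsto[OF g(2) tendsto_const] k(2) incident_commute by blast
  then obtain y where y: "y \<longlonglongrightarrow> x"
    "eventually (\<lambda>n. incident (y n) (psl_act (contragredient (g n)) k)) sequentially"
    using pl(2) by (rule incident_approximation)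
  have "eventually (\<lambda>n. y n \<in> Kul_limit_set G) sequentially"
    using y(2)
  proof eventually_elim
    case (elim n)
    have gn: "g n \<in> G" using g(1) by auto
    have "y n \<in> psl_act (g n) ` line_of k"
      using elim line_of_contragredient[OF in_carrier[OF gn]] by (auto simp: line_of_def)
    then obtain w where w: "y n = psl_act (g n) w" "w \<in> line_of k" by (rule imageE)
    have "w \<in> Kul_limit_set G" using A(3)[OF k(1)] w(2) by (rule subsetD)
    then show ?case unfolding w(1) by (rule Kul_invariant[OF gn])
  qed
  then show "x \<in> Kul_limit_set G"
    by (rule Lim_in_closed_set[OF closed_Kul _ sequentially_bot y(1)])
qed

lemma Kul_subset_Th: "Kul_limit_set G \<subseteq> Th"
  unfolding Kul_limit_set_def by (intro Un_least Kul_L0_subset Kul_L1_subset Kul_L2_subset)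

end

theorem theorem2:
  fixes G :: "sp3 set"
  assumes "subgroup G PSL3"
    and "discrete G"
    and "theta_divergent G"
  shows "(\<forall>S\<in>SP_boundary G. sp_rank S = 1)
    \<and> CoG_limit_set (contragredient ` G) = fst ` flag_limit_set G
    \<and> CoG_limit_set G = snd ` flag_limit_set G
    \<and> Myrberg_set G = (\<Union>l\<in>CoG_limit_set G. line_of l)
    \<and> (\<Union>l\<in>CoG_limit_set G. line_of l) = Th_inc (flag_limit_set G)
    \<and> Eq_set G = UNIV - Th_inc (flag_limit_set G)
    \<and> properly_discontinuous_on G (Eq_set G)
    \<and> ((\<exists>A. 3 \<le> card A \<and> lines_in_general_position A \<and> (\<forall>l\<in>A. line_of l \<subseteq> Kul_limit_set G)) \<longrightarrow>
         Kul_limit_set G = Myrberg_set G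
         \<and> Myrberg_set G = (\<Union>l\<in>CoG_limit_set G. line_of l)
         \<and> (\<Union>l\<in>CoG_limit_set G. line_of l) = Th_inc (flag_limit_set G)
         \<and> Kul_region G = Eq_set G
         \<and> Eq_set G = UNIV - Th_inc (flag_limit_set G))"
proof -
  interpret divergent_group G
    using assms(1,3) by (rule divergent_group.intro)
  have lines: "(\<Union>l\<in>CoG_limit_set G. line_of l) = Th"
    unfolding CoG_eq Th_inc_def by force
  have Myr: "Myrberg_set G = Th"
    by (simp add: Myrberg_set_def Eq_set_eq)
  have Eq: "Eq_set G = UNIV - Th"
    by (simp add: Eq_set_eq Compl_eq_Diff_UNIV)
  have pd: "properly_discontinuous_on G (Eq_set G)"
    unfolding Eq_set_eq by (rule properly_discontinuous_off_Th)
  have Kul: "Kul_limit_set G = Th"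
    if "\<exists>A. 3 \<le> card A \<and> lines_in_general_position A \<and> (\<forall>l\<in>A. line_of l \<subseteq> Kul_limit_set G)"
    using that Th_subset_Kul Kul_subset_Th by (metis subset_antisym)
  then have "Kul_region G = Eq_set G"
    if "\<exists>A. 3 \<le> card A \<and> lines_in_general_position A \<and> (\<forall>l\<in>A. line_of l \<subseteq> Kul_limit_set G)"
    using that by (simp add: Kul_region_def Eq_set_eq)
  with Kul show ?thesis
    using SP_boundary_rank CoG_contragredient CoG_eq lines Myr Eq pd by simp
qed

end
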